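(* (1) Every language in NP has a census function computable in FP if and only if $\mathrm{spanP}_1\subseteq\mathrm{FP}$. (2) Every language in PH has a census function computable in FP if and only if $\#_1\cdot\mathrm{PH}\subseteq\mathrm{FP}$.
   Context: Strings are over $\Sigma=\{0,1\}$; $\mathrm{census}_L(1^n)=|\{x\in L:|x|=n\}|$. FP is the class of polynomial-time computable functions; PH is the polynomial hierarchy. A tally spanP machine is a nondeterministic polynomial-time machine with unary input alphabet having an output device on which some output is printed on each accepting path; $\mathrm{span}_M(x)$ is the number of distinct outputs on accepting paths of $M(x)$ (0 if there is no accepting path). $\mathrm{spanP}_1$ is the class of functions $\mathrm{span}_M$ for tally spanP machines $M$. For a language class $\mathcal C$, $\#_1\cdot\mathcal C$ is the class of functions $f$ for which there exist $A\in\mathcal C$ and a polynomial $p$ with $f(1^n)=|\{y: |y|=p(n),\ \langle 1^n,y\rangle\in A\}|$ for all $n$, where $\langle\cdot,\cdot\rangle$ is a fixed polynomial-time computable and invertible bijective pairing function. *)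

theory Defs
  imports "HOL-Computational_Algebra.Polynomial"
begin

text \<open>
  Words over \<open>{0,1}\<close> are boolean lists, with \<open>True\<close> for the letter \<open>1\<close>.  The word \<open>1\<^sup>n\<close> is
  \<open>unary n\<close>, and a function with domain \<open>{1}\<^sup>*\<close> is represented as a function of \<open>n\<close>.
\<close>

type_synonym word = "bool list"

definition unary :: "nat \<Rightarrow> word" where
  "unary n = replicate n True"

section \<open>Turing machines\<close>

text \<open>
  Nondeterministic multi-tape machines.  States and tape symbols are taken from finite sets of
  natural numbers; symbol 0 is the blank and symbols 1 and 2 stand for the letters \<open>0\<close> and \<open>1\<close>.
  In addition to the work tapes there are two write-only devices, the query device and the output
  device, each of which can receive at most one further letter per step.

  A work tape is two-way infinite and is seen from its head: position 0 is the scanned cell, so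
  that moving the head shifts the tape.
\<close>

datatype move = Left | Stay | Right

type_synonym tape = "int \<Rightarrow> nat"

text \<open>
  Next state; symbol written and head move for each work tape; letter for the query device;
  letter for the output device.
\<close>
type_synonym action = "nat \<times> (nat \<times> move) list \<times> bool option \<times> bool option"

text \<open>
  If \<open>query_states M = Some (q, yes, no)\<close>, then \<open>q\<close> is the query state, and \<open>yes\<close>, \<open>no\<close> are the
  states entered according to the answer.  Machines without access to an oracle are those with
  \<open>query_states M = None\<close>.
\<close>
record machine =
  states :: "nat set"
  symbols :: "nat set"
  tapes :: nat
  start :: nat
  accepting :: "nat set"
  delta :: "nat \<Rightarrow> nat list \<Rightarrow> action set"
  query_states :: "(nat \<times> nat \<times> nat) option"

definition well_formed :: "machine \<Rightarrow> bool" where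
  "well_formed M \<longleftrightarrow>
     finite (states M) \<and> finite (symbols M) \<and> {0, 1, 2} \<subseteq> symbols M \<and> 1 \<le> tapes M \<and>
     start M \<in> states M \<and> accepting M \<subseteq> states M \<and>
     (\<forall>q yes no. query_states M = Some (q, yes, no) \<longrightarrow> {q, yes, no} \<subseteq> states M) \<and>
     (\<forall>q \<in> states M. \<forall>ss. length ss = tapes M \<and> set ss \<subseteq> symbols M \<longrightarrow>
        (\<forall>(q', ws, a, b) \<in> delta M q ss.
           q' \<in> states M \<and> length ws = tapes M \<and> fst ` set ws \<subseteq> symbols M))"

definition deterministic :: "machine \<Rightarrow> bool" where
  "deterministic M \<longleftrightarrow>
     (\<forall>q \<in> states M. \<forall>ss. length ss = tapes M \<and> set ss \<subseteq> symbols M \<longrightarrow>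
        (\<forall>r \<in> delta M q ss. \<forall>s \<in> delta M q ss. r = s))"

text \<open>State, work tapes, current content of the query device, output printed so far.\<close>
type_synonym config = "nat \<times> tape list \<times> word \<times> word"

definition word_tape :: "word \<Rightarrow> tape" where
  "word_tape x i = (if 0 \<le> i \<and> i < int (length x) then (if x ! nat i then 2 else 1) else 0)"

definition init :: "machine \<Rightarrow> word list \<Rightarrow> config" where
  "init M xs =
     (start M, map (\<lambda>i. if i < length xs then word_tape (xs ! i) else word_tape []) [0..<tapes M],
      [], [])"

fun shift :: "move \<Rightarrow> int" where
  "shift Left = -1"
| "shift Stay = 0"
| "shift Right = 1"

fun write_move :: "nat \<times> move \<Rightarrow> tape \<Rightarrow> tape" where
  "write_move (s, d) t = (\<lambda>i. (t(0 := s)) (i + shift d))"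

fun emit :: "bool option \<Rightarrow> word" where
  "emit None = []"
| "emit (Some c) = [c]"

text \<open>A query costs one step, in which the query device is erased.\<close>
inductive step :: "machine \<Rightarrow> word set \<Rightarrow> config \<Rightarrow> config \<Rightarrow> bool" for M A where
  transition:
    "\<lbrakk>\<And>yes no. query_states M \<noteq> Some (q, yes, no);
      (q', ws, a, b) \<in> delta M q (map (\<lambda>t. t 0) ts)\<rbrakk>
     \<Longrightarrow> step M A (q, ts, u, v) (q', map2 write_move ws ts, u @ emit a, v @ emit b)"
| query:
    "query_states M = Some (q, yes, no)
     \<Longrightarrow> step M A (q, ts, u, v) (if u \<in> A then yes else no, ts, [], v)"

text \<open>
  \<open>outputs M A xs\<close> is the set of words printed on the accepting computation paths of \<open>M\<close> with
  oracle \<open>A\<close> on input \<open>xs\<close>.  A path accepts if it halts in an accepting state; the printed word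
  may be empty, so this set is nonempty iff there is an accepting path.
\<close>
definition outputs :: "machine \<Rightarrow> word set \<Rightarrow> word list \<Rightarrow> word set" where
  "outputs M A xs =
     {v. \<exists>q ts u. (step M A)\<^sup>*\<^sup>* (init M xs) (q, ts, u, v) \<and>
        (\<nexists>c. step M A (q, ts, u, v) c) \<and> q \<in> accepting M}"

definition language :: "machine \<Rightarrow> word set \<Rightarrow> word set" where
  "language M A = {x. outputs M A [x] \<noteq> {}}"

text \<open>
  All computation paths, accepting or not, on inputs from \<open>D\<close> are polynomially bounded in the
  total input length.
\<close>
definition poly_time :: "machine \<Rightarrow> word set \<Rightarrow> word list set \<Rightarrow> bool" where
  "poly_time M A D \<longleftrightarrow>
     (\<exists>p :: nat poly. \<forall>xs \<in> D. \<forall>k c.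
        (step M A ^^ k) (init M xs) c \<longrightarrow> k \<le> poly p (length (concat xs)))"

section \<open>Complexity classes\<close>

definition class_P :: "word set set" where
  "class_P = {language M {} | M. well_formed M \<and> query_states M = None \<and> deterministic M \<and>
                poly_time M {} (range (\<lambda>x. [x]))}"

definition class_NP :: "word set set" where
  "class_NP = {language M {} | M. well_formed M \<and> query_states M = None \<and>
                 poly_time M {} (range (\<lambda>x. [x]))}"

definition NP_relative :: "word set \<Rightarrow> word set set" where
  "NP_relative A = {language M A | M. well_formed M \<and> poly_time M A (range (\<lambda>x. [x]))}"

primrec Sigma_p :: "nat \<Rightarrow> word set set" where
  "Sigma_p 0 = class_P"
| "Sigma_p (Suc k) = (\<Union>A \<in> Sigma_p k. NP_relative A)"

definition class_PH :: "word set set" where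
  "class_PH = (\<Union>k. Sigma_p k)"

definition class_FP :: "(word \<Rightarrow> word) set" where
  "class_FP = {F. \<exists>M. well_formed M \<and> query_states M = None \<and> deterministic M \<and>
                    poly_time M {} (range (\<lambda>x. [x])) \<and> (\<forall>x. outputs M {} [x] = {F x})}"

text \<open>Binary numerals without leading zeros, most significant digit first; 0 is the empty word.\<close>
fun binary :: "nat \<Rightarrow> word" where
  "binary n = (if n = 0 then [] else binary (n div 2) @ [odd n])"

declare binary.simps [simp del]

text \<open>Functions \<open>{1}\<^sup>* \<rightarrow> \<nat>\<close> that are computable in FP.\<close>
definition tally_FP :: "(nat \<Rightarrow> nat) set" where
  "tally_FP = {f. \<exists>F \<in> class_FP. \<forall>n. F (unary n) = binary (f n)}"

definition census :: "word set \<Rightarrow> nat \<Rightarrow> nat" where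
  "census L n = card {x \<in> L. length x = n}"

text \<open>A tally machine only receives unary inputs, so its time bound concerns these only.\<close>
definition spanP_1 :: "(nat \<Rightarrow> nat) set" where
  "spanP_1 = {f. \<exists>M. well_formed M \<and> query_states M = None \<and>
                   poly_time M {} (range (\<lambda>n. [unary n])) \<and>
                   (\<forall>n. f n = card (outputs M {} [unary n]))}"

text \<open>For computing a pairing function, the two components are given on separate tapes.\<close>
definition pairing_function :: "(word \<times> word \<Rightarrow> word) \<Rightarrow> bool" where
  "pairing_function pr \<longleftrightarrow>
     bij pr \<and>
     (\<exists>M. well_formed M \<and> 2 \<le> tapes M \<and> query_states M = None \<and> deterministic M \<and>
        poly_time M {} (range (\<lambda>(x, y). [x, y])) \<and>
        (\<forall>x y. outputs M {} [x, y] = {pr (x, y)})) \<and>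
     fst \<circ> inv pr \<in> class_FP \<and> snd \<circ> inv pr \<in> class_FP"

definition sharp_1 :: "(word \<times> word \<Rightarrow> word) \<Rightarrow> word set set \<Rightarrow> (nat \<Rightarrow> nat) set" where
  "sharp_1 pr \<C> = {f. \<exists>A \<in> \<C>. \<exists>p :: nat poly.
     \<forall>n. f n = card {y. length y = poly p n \<and> pr (unary n, y) \<in> A}}"

end

theory Submission
  imports Defs "HOL-Library.Countable"
begin

text \<open>
  Counting is turned into a census by encoding \<open>n\<close> in the length of the counted words.  If \<open>M\<close> is
  a tally machine with time bound \<open>p\<close>, the words \<open>1\<^sup>n 0 1\<^sup>j 0 v\<close> with \<open>j + |v| = p(n)\<close> and \<open>v\<close> an
  output of \<open>M(1\<^sup>n)\<close> form a language in NP; as \<open>n + p(n) + 2\<close> is injective in \<open>n\<close>, its census at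
  this length is the number of outputs of \<open>M(1\<^sup>n)\<close>.  For a set \<open>A\<close> in PH, the words \<open>1\<^sup>n 0 y\<close> with
  \<open>|y| = p(n)\<close> and \<open>\<langle>1\<^sup>n, y\<rangle>\<close> in \<open>A\<close> form a language in \<open>NP\<^sup>A\<close>, hence in PH.
  Conversely, a tally machine can guess and print a word \<open>y\<close> of length \<open>n\<close> and then check that \<open>y\<close>
  belongs to a given language in NP, and \<open>{x. snd (inv pr x) \<in> L}\<close> is in \<open>NP\<^sup>L\<close>.

  All machines needed are given by programs of a small while language with a command that runs an
  embedded machine.  The states of the machine for a program are the residual programs.
\<close>

section \<open>Polynomial bounds\<close>

text \<open>\<open>poly_time\<close> bounds every computation path, also those that block or reject,
  so knowing the final configurations is not enough: each program is specified by its reachable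
  final stores together with a bound on all its runs. A tally machine is moreover bounded on unary
  inputs only, so a program starts it only on a word 1^n that it has itself written, with n at most
  the length of the given word. Outputs of M(1^n) differ in length, but have at most p(n) letters
  since a step prints at most one; the block 1^j brings them to a common length, and j is determined
  by v. Adding n to the length matters because p is only nondecreasing and may even be constant. In
  the PH part both oracle machines ask a single query, as their last step, so the program language
  itself needs no oracle command. Passing from A to NP relative to A costs one level of the
  hierarchy, which the union over all levels absorbs. To return from a census to the function it
  encodes, an FP machine is run on a unary word of polynomial length; the program producing this
  word uses only the length of its input and is therefore total on words.\<close>

lemma poly_nat_mono:
  fixes p :: "nat poly"
  assumes "x \<le> y"
  shows "poly p x \<le> poly p y"
  by (induction p) (auto intro!: add_mono mult_mono assms)

text \<open>Running times such as \<open>horner_time\<close> arise by recursion rather than as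
  polynomials; a polynomial majorant is enough and is preserved by the operations that build up time
  bounds.\<close>

definition poly_bounded :: "(nat \<Rightarrow> nat) \<Rightarrow> bool" where
  "poly_bounded f \<longleftrightarrow> (\<exists>p :: nat poly. \<forall>n. f n \<le> poly p n)"

lemma poly_bounded_const: "poly_bounded (\<lambda>n. c)"
  unfolding poly_bounded_def by (rule exI[of _ "[:c:]"]) simp

lemma poly_bounded_id: "poly_bounded (\<lambda>n. n)"
  unfolding poly_bounded_def by (rule exI[of _ "[:0, 1:]"]) simp

lemma poly_bounded_add:
  assumes "poly_bounded f" "poly_bounded g"
  shows "poly_bounded (\<lambda>n. f n + g n)"
proof -
  obtain p q :: "nat poly" where "\<forall>n. f n \<le> poly p n" "\<forall>n. g n \<le> poly q n"
    using assms unfolding poly_bounded_def by blast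
  then have "\<forall>n. f n + g n \<le> poly (p + q) n"
    by (simp add: add_mono)
  then show ?thesis unfolding poly_bounded_def by blast
qed

lemma poly_bounded_mult:
  assumes "poly_bounded f" "poly_bounded g"
  shows "poly_bounded (\<lambda>n. f n * g n)"
proof -
  obtain p q :: "nat poly" where "\<forall>n. f n \<le> poly p n" "\<forall>n. g n \<le> poly q n"
    using assms unfolding poly_bounded_def by blast
  then have "\<forall>n. f n * g n \<le> poly (p * q) n"
    by (simp add: mult_mono)
  then show ?thesis unfolding poly_bounded_def by blast
qed

lemma poly_bounded_poly:
  assumes "poly_bounded f"
  shows "poly_bounded (\<lambda>n. poly p (f n))"
proof -
  obtain q :: "nat poly" where "\<forall>n. f n \<le> poly q n"
    using assms unfolding poly_bounded_def by blast
  then have "\<forall>n. poly p (f n) \<le> poly (pcompose p q) n"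
    by (simp add: poly_pcompose poly_nat_mono)
  then show ?thesis unfolding poly_bounded_def by blast
qed

lemmas poly_bounded_intros =
  poly_bounded_const poly_bounded_id poly_bounded_add poly_bounded_mult poly_bounded_poly

section \<open>Programs\<close>

instance move :: countable
  by countable_datatype

text \<open>
  \<open>Chk i S\<close> blocks unless the symbol scanned on tape \<open>i\<close> lies in \<open>S\<close>, and \<open>Guess j\<close> writes an
  arbitrary letter on tape \<open>j\<close> and prints it.  \<open>Run q\<close> continues an embedded machine in state \<open>q\<close>.
\<close>
datatype com =
    Skip
  | Op "nat list" "nat option" move
  | Cpy nat nat
  | Chk nat "nat list"
  | Guess nat
  | Run nat
  | While nat "nat list" com
  | Seq com com (infixr ";;" 60)

instance com :: countable
  by countable_datatype

text \<open>What happens to the letters printed by the embedded machine.\<close>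
datatype mode = Out | Query | Drop | Compare nat

type_synonym store = "(nat \<Rightarrow> tape) \<times> word \<times> word"

definition letter :: "bool \<Rightarrow> nat" where
  "letter c = (if c then 2 else 1)"

definition hold :: "(nat \<Rightarrow> nat) \<Rightarrow> nat \<Rightarrow> nat \<times> move" where
  "hold h i = (h i, Stay)"

lemma write_move_same: "s = t 0 \<Longrightarrow> write_move (s, d) t = (\<lambda>i. t (i + shift d))"
  by (auto simp: fun_eq_iff)

lemma write_move_Stay [simp]: "write_move (t 0, Stay) t = t"
  by (auto simp: fun_eq_iff)

declare write_move.simps [simp del] split_paired_Ex [simp del] split_paired_All [simp del]

text \<open>The machine \<open>M\<close> is embedded on the tapes \<open>b, b + 1, \<dots>\<close>.\<close>
locale embedding =
  fixes M :: machine and b :: nat and md :: mode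
  assumes Compare_outside: "md = Compare j \<Longrightarrow> j < b \<or> b + tapes M \<le> j"
    and wf: "well_formed M" and no_query: "query_states M = None"
begin

text \<open>Commands act on an unbounded family of tapes, so the meaning of a program does not
  depend on the number of tapes of the machine compiled from it. For \<open>Run\<close>, an
  accepting halt becomes \<open>Skip\<close> and a rejecting halt blocks, so only accepting paths
  continue. The condition \<open>q' \<in> states M\<close> keeps the residual programs in a finite
  set. In mode \<open>Compare j\<close> a transition that prints a letter other than the one scanned
  on tape \<open>j\<close> is removed.\<close>

primrec cdelta :: "com \<Rightarrow> (nat \<Rightarrow> nat) \<Rightarrow>
    (com \<times> (nat \<Rightarrow> nat \<times> move) \<times> bool option \<times> bool option) set" where
  "cdelta Skip h = {}"
| "cdelta (Op ts s d) h =
     {(Skip, \<lambda>i. if i \<in> set ts then (case s of None \<Rightarrow> h i | Some s \<Rightarrow> s, d) else hold h i, None, None)}"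
| "cdelta (Cpy i j) h =
     {(Skip, (hold h)(i := (h i, Right), j := (h i, Right)), None, None)}"
| "cdelta (Chk i S) h = (if h i \<in> set S then {(Skip, hold h, None, None)} else {})"
| "cdelta (Guess j) h = {(Skip, (hold h)(j := (letter c, Right)), None, Some c) | c. True}"
| "cdelta (Run q) h =
     {(Run q',
       \<lambda>i. if b \<le> i \<and> i < b + tapes M then ws ! (i - b)
           else if md = Compare i \<and> e \<noteq> None then (h i, Right) else hold h i,
       if md = Query then e else None, if md = Out then e else None) | q' ws a e.
      (q', ws, a, e) \<in> delta M q (map (\<lambda>i. h (b + i)) [0..<tapes M]) \<and> q' \<in> states M \<and>
      (\<forall>j c. md = Compare j \<longrightarrow> e = Some c \<longrightarrow> h j = letter c)} \<union>
     (if delta M q (map (\<lambda>i. h (b + i)) [0..<tapes M]) = {} \<and> q \<in> accepting M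
      then {(Skip, hold h, None, None)} else {})"
| "cdelta (While i S c) h =
     {(if h i \<in> set S then c ;; While i S c else Skip, hold h, None, None)}"
| "cdelta (c ;; d) h =
     (if c = Skip then {(d, hold h, None, None)}
      else {(c' ;; d, acts, a, e) | c' acts a e. (c', acts, a, e) \<in> cdelta c h})"

inductive cstep :: "com \<times> store \<Rightarrow> com \<times> store \<Rightarrow> bool" where
  "(c', acts, a, e) \<in> cdelta c (\<lambda>i. \<tau> i 0) \<Longrightarrow>
   cstep (c, \<tau>, u, v) (c', \<lambda>i. write_move (acts i) (\<tau> i), u @ emit a, v @ emit e)"

lemma cstep_iff:
  "cstep (c, \<tau>, u, v) y \<longleftrightarrow>
   (\<exists>c' acts a e. (c', acts, a, e) \<in> cdelta c (\<lambda>i. \<tau> i 0) \<and>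
      y = (c', \<lambda>i. write_move (acts i) (\<tau> i), u @ emit a, v @ emit e))"
  by (auto simp: cstep.simps)

lemma write_move_hold [simp]: "(\<lambda>i. write_move (hold (\<lambda>i. \<tau> i 0) i) (\<tau> i)) = \<tau>"
  by (auto simp: fun_eq_iff hold_def)

lemma write_move_hold' [simp]: "h i = t 0 \<Longrightarrow> write_move (hold h i) t = t"
  by (simp add: hold_def)

lemma cstep_Skip [simp]: "\<not> cstep (Skip, s) y"
  by (cases s) (simp add: cstep_iff)

lemma write_move_if:
  "write_move (if P then x else y) t = (if P then write_move x t else write_move y t)"
  by simp

lemma cstep_Op:
  "cstep (Op ts s d, \<tau>, u, v) y \<longleftrightarrow>
   y = (Skip, \<lambda>i. if i \<in> set ts
          then write_move (case s of None \<Rightarrow> \<tau> i 0 | Some s \<Rightarrow> s, d) (\<tau> i) else \<tau> i, u, v)"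
  by (simp add: cstep_iff write_move_if cong: if_cong)

lemma cstep_Cpy:
  "cstep (Cpy i j, \<tau>, u, v) y \<longleftrightarrow>
   y = (Skip, \<tau>(i := write_move (\<tau> i 0, Right) (\<tau> i), j := write_move (\<tau> i 0, Right) (\<tau> j)), u, v)"
proof -
  let ?h = "\<lambda>i. \<tau> i 0"
  have "(\<lambda>k. write_move (((hold ?h)(i := (\<tau> i 0, Right), j := (\<tau> i 0, Right))) k) (\<tau> k)) =
    \<tau>(i := write_move (\<tau> i 0, Right) (\<tau> i), j := write_move (\<tau> i 0, Right) (\<tau> j))"
    by (rule ext) simp
  then show ?thesis by (simp add: cstep_iff)
qed

lemma cstep_Chk:
  "cstep (Chk i S, \<tau>, u, v) y \<longleftrightarrow> \<tau> i 0 \<in> set S \<and> y = (Skip, \<tau>, u, v)"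
  by (auto simp: cstep_iff)

lemma cstep_Guess:
  "cstep (Guess j, \<tau>, u, v) y \<longleftrightarrow>
   (\<exists>c. y = (Skip, \<tau>(j := write_move (letter c, Right) (\<tau> j)), u, v @ [c]))"
proof -
  let ?h = "\<lambda>i. \<tau> i 0"
  have eq: "(\<lambda>k. write_move (((hold ?h)(j := (letter c, Right))) k) (\<tau> k)) =
    \<tau>(j := write_move (letter c, Right) (\<tau> j))" for c
    by (rule ext) simp
  have "cstep (Guess j, \<tau>, u, v) y \<longleftrightarrow> (\<exists>c acts a e. acts = (hold ?h)(j := (letter c, Right)) \<and>
      a = None \<and> e = Some c \<and>
      y = (Skip, \<lambda>k. write_move (acts k) (\<tau> k), u @ emit a, v @ emit e))"
    unfolding cstep_iff cdelta.simps by blast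
  also have "\<dots> \<longleftrightarrow> (\<exists>c. y = (Skip, \<tau>(j := write_move (letter c, Right) (\<tau> j)), u, v @ [c]))"
    using eq by (simp del: fun_upd_apply)
  finally show ?thesis .
qed

lemma cstep_While:
  "cstep (While i S c, \<tau>, u, v) y \<longleftrightarrow>
   y = (if \<tau> i 0 \<in> set S then c ;; While i S c else Skip, \<tau>, u, v)"
  by (auto simp: cstep_iff)

lemma cstep_Seq:
  "cstep (c ;; d, s) y \<longleftrightarrow>
   (if c = Skip then y = (d, s) else (\<exists>c' s'. cstep (c, s) (c', s') \<and> y = (c' ;; d, s')))"
  by (cases s) (auto simp: cstep_iff; blast)

text \<open>\<open>Z\<close> collects the final stores of all runs that are not blocked; \<open>T\<close> bounds all runs.\<close>
definition exec :: "com \<Rightarrow> store \<Rightarrow> store set \<Rightarrow> nat \<Rightarrow> bool" where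
  "exec c s Z T \<longleftrightarrow>
     (\<forall>s'. cstep\<^sup>*\<^sup>* (c, s) (Skip, s') \<longleftrightarrow> s' \<in> Z) \<and> (\<forall>k y. (cstep ^^ k) (c, s) y \<longrightarrow> k \<le> T)"

section \<open>Final stores and running times of commands\<close>

lemma execI:
  assumes "\<And>s'. cstep\<^sup>*\<^sup>* (c, s) (Skip, s') \<longleftrightarrow> s' \<in> Z" "\<And>k y. (cstep ^^ k) (c, s) y \<Longrightarrow> k \<le> T"
  shows "exec c s Z T"
  using assms unfolding exec_def by blast

lemma exec_final: "exec c s Z T \<Longrightarrow> cstep\<^sup>*\<^sup>* (c, s) (Skip, s') \<longleftrightarrow> s' \<in> Z"
  unfolding exec_def by blast

lemma exec_time: "exec c s Z T \<Longrightarrow> (cstep ^^ k) (c, s) y \<Longrightarrow> k \<le> T"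
  unfolding exec_def by blast

lemma exec_mono: "exec c s Z T \<Longrightarrow> T \<le> T' \<Longrightarrow> exec c s Z T'"
  by (meson execI exec_final exec_time le_trans)

lemma exec_first_step:
  assumes c: "c \<noteq> Skip" and step: "\<And>y. cstep (c, s) y \<longleftrightarrow> y = (c', s')" and exec: "exec c' s' Z T"
  shows "exec c s Z (Suc T)"
proof (rule execI)
  fix r
  have "cstep\<^sup>*\<^sup>* (c, s) (Skip, r) \<longleftrightarrow> cstep\<^sup>*\<^sup>* (c', s') (Skip, r)"
  proof
    assume "cstep\<^sup>*\<^sup>* (c, s) (Skip, r)"
    then show "cstep\<^sup>*\<^sup>* (c', s') (Skip, r)"
      by (cases rule: converse_rtranclpE) (use c step in auto)
  next
    assume "cstep\<^sup>*\<^sup>* (c', s') (Skip, r)"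
    moreover have "cstep (c, s) (c', s')" by (simp only: step)
    ultimately show "cstep\<^sup>*\<^sup>* (c, s) (Skip, r)" by (rule converse_rtranclp_into_rtranclp[rotated])
  qed
  then show "cstep\<^sup>*\<^sup>* (c, s) (Skip, r) \<longleftrightarrow> r \<in> Z"
    by (simp only: exec_final[OF exec])
next
  fix k y
  assume k: "(cstep ^^ k) (c, s) y"
  show "k \<le> Suc T"
  proof (cases k)
    case (Suc j)
    then have "(cstep ^^ j) (c', s') y"
      using k step by (metis relpowp_Suc_D2)
    then show ?thesis using exec_time[OF exec] Suc by simp
  qed simp
qed

lemma exec_Skip: "exec Skip s {s} 0"
proof (rule execI)
  show "cstep\<^sup>*\<^sup>* (Skip, s) (Skip, r) \<longleftrightarrow> r \<in> {s}" for r
    by (auto elim: converse_rtranclpE)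
  show "k \<le> 0" if "(cstep ^^ k) (Skip, s) y" for k y
    using that by (cases k) (auto dest!: relpowp_Suc_D2 simp del: relpowp.simps)
qed

lemma exec_one_step:
  assumes c: "c \<noteq> Skip" and step: "\<And>y. cstep (c, s) y \<longleftrightarrow> (\<exists>s' \<in> Z. y = (Skip, s'))"
  shows "exec c s Z 1"
proof (rule execI)
  fix r
  show "cstep\<^sup>*\<^sup>* (c, s) (Skip, r) \<longleftrightarrow> r \<in> Z"
  proof
    assume "cstep\<^sup>*\<^sup>* (c, s) (Skip, r)"
    then obtain y where y: "cstep (c, s) y" "cstep\<^sup>*\<^sup>* y (Skip, r)"
      using c by (auto elim: converse_rtranclpE)
    from y(1) obtain s' where s': "s' \<in> Z" "y = (Skip, s')"
      unfolding step by blast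
    with y(2) show "r \<in> Z"
      using exec_final[OF exec_Skip, of s' r] by simp
  next
    assume "r \<in> Z"
    then have "cstep (c, s) (Skip, r)" by (simp add: step)
    then show "cstep\<^sup>*\<^sup>* (c, s) (Skip, r)" ..
  qed
next
  fix k y
  assume k: "(cstep ^^ k) (c, s) y"
  show "k \<le> 1"
  proof (cases k)
    case (Suc j)
    with k obtain z where z: "cstep (c, s) z" "(cstep ^^ j) z y"
      by (blast dest: relpowp_Suc_D2)
    from z(1) obtain s' where "z = (Skip, s')"
      unfolding step by blast
    then show ?thesis using z(2) exec_time[OF exec_Skip, of j s' y] Suc by simp
  qed simp
qed

lemma exec_Op:
  "exec (Op ts s d) (\<tau>, u, v)
     {(\<lambda>i. if i \<in> set ts
         then write_move (case s of None \<Rightarrow> \<tau> i 0 | Some s \<Rightarrow> s, d) (\<tau> i) else \<tau> i, u, v)} 1"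
  by (rule exec_one_step) (simp_all add: cstep_Op)

lemma exec_Cpy:
  "exec (Cpy i j) (\<tau>, u, v)
     {(\<tau>(i := write_move (\<tau> i 0, Right) (\<tau> i), j := write_move (\<tau> i 0, Right) (\<tau> j)), u, v)} 1"
  by (rule exec_one_step) (simp_all add: cstep_Cpy)

lemma exec_Chk:
  "exec (Chk i S) (\<tau>, u, v) (if \<tau> i 0 \<in> set S then {(\<tau>, u, v)} else {}) 1"
  by (rule exec_one_step) (simp_all add: cstep_Chk)

lemma exec_Guess:
  "exec (Guess j) (\<tau>, u, v)
     (range (\<lambda>c. (\<tau>(j := write_move (letter c, Right) (\<tau> j)), u, v @ [c]))) 1"
  by (rule exec_one_step) (auto simp: cstep_Guess)

text \<open>The extra step in the second case discards the finished \<open>Skip\<close> in front of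
  \<open>d\<close>; it is the source of the \<open>+ 1\<close> in the time of every
  sequence.\<close>

lemma Seq_decompose:
  assumes "(cstep ^^ k) (c ;; d, s) y"
  shows "(\<exists>c' s'. y = (c' ;; d, s') \<and> (cstep ^^ k) (c, s) (c', s')) \<or>
    (\<exists>i j s'. k = Suc (i + j) \<and> (cstep ^^ i) (c, s) (Skip, s') \<and> (cstep ^^ j) (d, s') y)"
  using assms
proof (induction k arbitrary: c s)
  case 0
  then show ?case by auto
next
  case (Suc k)
  from Suc.prems obtain z where z: "cstep (c ;; d, s) z" "(cstep ^^ k) z y"
    by (blast dest: relpowp_Suc_D2)
  show ?case
  proof (cases "c = Skip")
    case True
    then have "Suc k = Suc (0 + k)" "(cstep ^^ 0) (c, s) (Skip, s)" "(cstep ^^ k) (d, s) y"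
      using z by (auto simp: cstep_Seq)
    then show ?thesis by blast
  next
    case False
    then obtain c' s' where c': "cstep (c, s) (c', s')" "z = (c' ;; d, s')"
      using z by (auto simp: cstep_Seq)
    from Suc.IH[of c' s'] z(2) c'(2) consider
      c'' s'' where "y = (c'' ;; d, s'')" "(cstep ^^ k) (c', s') (c'', s'')"
      | i j s'' where "k = Suc (i + j)" "(cstep ^^ i) (c', s') (Skip, s'')" "(cstep ^^ j) (d, s'') y"
      by blast
    then show ?thesis
    proof cases
      case 1
      then show ?thesis using c'(1) by (blast intro: relpowp_Suc_I2)
    next
      case (2 i j s'')
      then have "Suc k = Suc (Suc i + j)" "(cstep ^^ Suc i) (c, s) (Skip, s'')"
        using c'(1) by (auto intro: relpowp_Suc_I2 simp del: relpowp.simps)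
      then show ?thesis using 2(3) by blast
    qed
  qed
qed

lemma Seq_left:
  assumes "cstep\<^sup>*\<^sup>* (c, s) (c', s')"
  shows "cstep\<^sup>*\<^sup>* (c ;; d, s) (c' ;; d, s')"
  using assms
proof (induction rule: rtranclp_induct2)
  case (step c' s' c'' s'')
  then have "cstep (c' ;; d, s') (c'' ;; d, s'')"
    by (auto simp: cstep_Seq)
  then show ?case using step.IH by simp
qed simp

text \<open>A nondeterministic \<open>c\<close> may end in any store of \<open>Z\<close>; the final
  stores of \<open>d\<close> depend on the one reached, while the bound \<open>T'\<close> is
  uniform.\<close>

lemma exec_Seq:
  assumes c: "exec c s Z T" and d: "\<And>r. r \<in> Z \<Longrightarrow> exec d r (Z' r) T'"
  shows "exec (c ;; d) s (\<Union>r \<in> Z. Z' r) (T + T' + 1)"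
proof (rule execI)
  fix r'
  show "cstep\<^sup>*\<^sup>* (c ;; d, s) (Skip, r') \<longleftrightarrow> r' \<in> (\<Union>r \<in> Z. Z' r)"
  proof
    assume "cstep\<^sup>*\<^sup>* (c ;; d, s) (Skip, r')"
    then obtain k where "(cstep ^^ k) (c ;; d, s) (Skip, r')"
      by (blast dest: rtranclp_imp_relpowp)
    from Seq_decompose[OF this] obtain i j r where
      "(cstep ^^ i) (c, s) (Skip, r)" "(cstep ^^ j) (d, r) (Skip, r')" by auto
    then have "r \<in> Z" "cstep\<^sup>*\<^sup>* (d, r) (Skip, r')"
      by (simp_all add: exec_final[OF c, symmetric] relpowp_imp_rtranclp)
    then show "r' \<in> (\<Union>r \<in> Z. Z' r)" using exec_final[OF d] by blast
  next
    assume "r' \<in> (\<Union>r \<in> Z. Z' r)"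
    then obtain r where r: "r \<in> Z" "r' \<in> Z' r" by blast
    have "cstep\<^sup>*\<^sup>* (c ;; d, s) (Skip ;; d, r)" "cstep\<^sup>*\<^sup>* (d, r) (Skip, r')"
      using exec_final[OF c] exec_final[OF d] r by (blast intro: Seq_left)+
    moreover have "cstep (Skip ;; d, r) (d, r)"
      by (simp add: cstep_Seq)
    ultimately show "cstep\<^sup>*\<^sup>* (c ;; d, s) (Skip, r')" by (meson converse_rtranclp_into_rtranclp rtranclp_trans)
  qed
next
  fix k y
  assume "(cstep ^^ k) (c ;; d, s) y"
  from Seq_decompose[OF this] show "k \<le> T + T' + 1"
  proof (elim disjE exE conjE)
    fix c'' s' assume "(cstep ^^ k) (c, s) (c'', s')"
    then show ?thesis using exec_time[OF c] by fastforce
  next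
    fix i j s'
    assume *: "k = Suc (i + j)" "(cstep ^^ i) (c, s) (Skip, s')" "(cstep ^^ j) (d, s') y"
    then have "s' \<in> Z" by (simp add: exec_final[OF c, symmetric] relpowp_imp_rtranclp)
    then have "i \<le> T" "j \<le> T'" using exec_time[OF c *(2)] exec_time[OF d *(3)] by simp_all
    then show ?thesis using * by simp
  qed
qed

lemma exec_Seq_det:
  assumes "exec c s {r} T" and "exec d r Z T'"
  shows "exec (c ;; d) s Z (T + T' + 1)"
  using exec_Seq[OF assms(1), of d "\<lambda>_. Z" T'] assms(2) by simp

lemma exec_Seq_Chk:
  assumes "exec d (\<tau>, u, v) Z T"
  shows "exec (Chk i S ;; d) (\<tau>, u, v) (if \<tau> i 0 \<in> set S then Z else {}) (T + 2)"
  using exec_Seq[OF exec_Chk[of i S \<tau> u v], of d "\<lambda>_. Z" T] assms by (auto split: if_splits)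

lemma exec_While_stop:
  assumes "\<tau> i 0 \<notin> set S"
  shows "exec (While i S c) (\<tau>, u, v) {(\<tau>, u, v)} 1"
  by (rule exec_one_step) (use assms in \<open>auto simp: cstep_While\<close>)

lemma exec_While_loop:
  assumes "\<tau> i 0 \<in> set S" and "exec (c ;; While i S c) (\<tau>, u, v) Z T"
  shows "exec (While i S c) (\<tau>, u, v) Z (Suc T)"
  by (rule exec_first_step[OF _ _ assms(2)]) (use assms(1) in \<open>auto simp: cstep_While\<close>)

text \<open>For deterministic loops that print nothing: \<open>\<tau> k\<close> describes the tapes
  after \<open>k\<close> rounds. A round costs \<open>T\<close>, one step for the test and one for
  discarding the finished body; the last \<open>1\<close> is the failing test.\<close>

lemma exec_While_iterate:
  assumes "\<And>k. k < n \<Longrightarrow> \<tau> k i 0 \<in> set S" and "\<tau> n i 0 \<notin> set S"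
    and "\<And>k. k < n \<Longrightarrow> exec c (\<tau> k, u, v) {(\<tau> (Suc k), u, v)} T"
  shows "exec (While i S c) (\<tau> 0, u, v) {(\<tau> n, u, v)} (n * (T + 2) + 1)"
  using assms
proof (induction n arbitrary: \<tau>)
  case 0
  then show ?case using exec_While_stop[of "\<tau> 0" i S c u v] by simp
next
  case (Suc n)
  have "exec (While i S c) (\<tau> 1, u, v) {(\<tau> (Suc n), u, v)} (n * (T + 2) + 1)"
    using Suc.IH[of "\<lambda>k. \<tau> (Suc k)"] Suc.prems by simp
  moreover have "exec c (\<tau> 0, u, v) {(\<tau> 1, u, v)} T"
    using Suc.prems(3)[of 0] by simp
  ultimately have "exec (c ;; While i S c) (\<tau> 0, u, v) {(\<tau> (Suc n), u, v)} (T + (n * (T + 2) + 1) + 1)"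
    by (blast intro: exec_Seq_det)
  then have "exec (While i S c) (\<tau> 0, u, v) {(\<tau> (Suc n), u, v)} (Suc (T + (n * (T + 2) + 1) + 1))"
    using Suc.prems(1) by (intro exec_While_loop) auto
  then show ?case by (simp add: algebra_simps)
qed

section \<open>Simulation of the embedded machine by \<open>Run\<close>\<close>

lemma cstepI:
  assumes "(c', acts, a, e) \<in> cdelta c h" "h = (\<lambda>i. \<tau> i 0)"
    "y = (c', \<lambda>i. write_move (acts i) (\<tau> i), u @ emit a, v @ emit e)"
  shows "cstep (c, \<tau>, u, v) y"
  using assms unfolding cstep_iff by blast

lemma M_step_iff:
  "step M A (q, ts, u, v) y \<longleftrightarrow>
   (\<exists>q' ws a e. (q', ws, a, e) \<in> delta M q (map (\<lambda>t. t 0) ts) \<and>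
      y = (q', map2 write_move ws ts, u @ emit a, v @ emit e))"
  by (subst step.simps) (auto simp: no_query)

text \<open>\<open>well_formed\<close> constrains \<open>delta\<close> only at states and symbols of
  the machine, so this invariant is what guarantees that a transition supplies one action for each
  tape.\<close>

fun valid :: "config \<Rightarrow> bool" where
  "valid (q, ts, u, v) \<longleftrightarrow>
     q \<in> states M \<and> length ts = tapes M \<and> (\<forall>t \<in> set ts. range t \<subseteq> symbols M)"

lemma symbols_M: "finite (symbols M)" "0 \<in> symbols M" "Suc 0 \<in> symbols M" "2 \<in> symbols M"
  using wf by (auto simp: well_formed_def)

lemma valid_init: "valid (init M xs)"
  using wf by (auto simp: init_def well_formed_def word_tape_def)

lemma delta_M:
  assumes "valid (q, ts, u, v)" and "(q', ws, a, e) \<in> delta M q (map (\<lambda>t. t 0) ts)"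
  shows "q' \<in> states M" "length ws = tapes M" "fst ` set ws \<subseteq> symbols M"
proof -
  have "q \<in> states M" "length (map (\<lambda>t. t 0) ts) = tapes M" "set (map (\<lambda>t. t 0) ts) \<subseteq> symbols M"
    using assms(1) by auto
  then have "\<forall>(q', ws, a, b) \<in> delta M q (map (\<lambda>t. t 0) ts).
      q' \<in> states M \<and> length ws = tapes M \<and> fst ` set ws \<subseteq> symbols M"
    using wf unfolding well_formed_def by meson
  with assms(2) show "q' \<in> states M" "length ws = tapes M" "fst ` set ws \<subseteq> symbols M"
    by blast+
qed

lemma valid_step:
  assumes "valid x" and "step M A x y"
  shows "valid y"
proof -
  obtain q ts u v where x: "x = (q, ts, u, v)" by (metis surj_pair)
  from assms(2) obtain q' ws a e where
    d: "(q', ws, a, e) \<in> delta M q (map (\<lambda>t. t 0) ts)"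
    and y: "y = (q', map2 write_move ws ts, u @ emit a, v @ emit e)"
    unfolding x M_step_iff by blast
  note ws = delta_M[OF assms(1)[unfolded x] d]
  have "range (write_move p t) \<subseteq> symbols M" if "(p, t) \<in> set (zip ws ts)" for p t
  proof -
    have "fst p \<in> symbols M" "range t \<subseteq> symbols M"
      using set_zip_leftD[OF that] set_zip_rightD[OF that] ws(3) assms(1) x by auto
    then show ?thesis by (cases p) (auto simp: write_move.simps)
  qed
  then have "range t \<subseteq> symbols M" if "t \<in> set (map2 write_move ws ts)" for t
    using that by force
  then show ?thesis using ws assms(1) x y by simp
qed

text \<open>
  The store in which the embedded machine, started in the store \<open>s\<close>, has the tapes \<open>ts\<close> and has
  printed \<open>w\<close>.  With mode \<open>Compare j\<close> it can print \<open>w\<close> only if \<open>w\<close> is written on tape \<open>j\<close>.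
\<close>
definition place :: "store \<Rightarrow> tape list \<Rightarrow> word \<Rightarrow> store" where
  "place s ts w =
     (\<lambda>i. if b \<le> i \<and> i < b + tapes M then ts ! (i - b)
          else if md = Compare i then \<lambda>k. fst s i (k + int (length w)) else fst s i,
      fst (snd s) @ (if md = Query then w else []), snd (snd s) @ (if md = Out then w else []))"

definition matches :: "store \<Rightarrow> word \<Rightarrow> bool" where
  "matches s w \<longleftrightarrow>
     (\<forall>j. md = Compare j \<longrightarrow> (\<forall>k < length w. fst s j (int k) = letter (w ! k)))"

lemma matches_Nil [simp]: "matches s []"
  by (simp add: matches_def)

lemma matches_append: "matches s (w @ w') \<Longrightarrow> matches s w"
  by (auto simp: matches_def nth_append)

text \<open>The compared tape lies outside the tapes of \<open>M\<close>, so only the comparison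
  moves its head, one cell per printed letter; after \<open>w\<close> it scans the cell that the
  next letter must equal.\<close>

lemma matches_emit:
  "matches s (w @ emit e) \<longleftrightarrow>
   matches s w \<and> (\<forall>j c. md = Compare j \<longrightarrow> e = Some c \<longrightarrow> fst (place s ts w) j 0 = letter c)"
proof (cases e)
  case (Some c)
  have "fst (place s ts w) j 0 = fst s j (int (length w))" if "md = Compare j" for j
    using Compare_outside[OF that] that unfolding place_def by auto
  then show ?thesis using Some by (auto simp: matches_def nth_append less_Suc_eq)
qed simp

lemma place_step:
  assumes "length ts = tapes M" "length ws = tapes M" and pl: "place s ts w = (\<tau>, u, v)"
  shows "(\<lambda>i. write_move (if b \<le> i \<and> i < b + tapes M then ws ! (i - b)
       else if md = Compare i \<and> e \<noteq> None then (\<tau> i 0, Right) else hold (\<lambda>i. \<tau> i 0) i) (\<tau> i),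
     u @ emit (if md = Query then e else None), v @ emit (if md = Out then e else None)) =
    place s (map2 write_move ws ts) (w @ emit e)"
proof -
  have u: "u = fst (snd s) @ (if md = Query then w else [])"
    and v: "v = snd (snd s) @ (if md = Out then w else [])"
    and \<tau>: "\<tau> i = (if b \<le> i \<and> i < b + tapes M then ts ! (i - b)
          else if md = Compare i then \<lambda>k. fst s i (k + int (length w)) else fst s i)" for i
    using pl by (auto simp: place_def)
  have "(\<lambda>i. write_move (if b \<le> i \<and> i < b + tapes M then ws ! (i - b)
       else if md = Compare i \<and> e \<noteq> None then (\<tau> i 0, Right) else hold (\<lambda>i. \<tau> i 0) i) (\<tau> i)) =
    fst (place s (map2 write_move ws ts) (w @ emit e))"
    using assms(1,2)
    by (cases e) (auto simp: fun_eq_iff place_def \<tau> write_move_same algebra_simps)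
  moreover have "u @ emit (if md = Query then e else None) = fst (snd (place s (map2 write_move ws ts) (w @ emit e)))"
    "v @ emit (if md = Out then e else None) = snd (snd (place s (map2 write_move ws ts) (w @ emit e)))"
    by (auto simp: place_def u v)
  ultimately show ?thesis by (simp add: prod_eq_iff)
qed

lemma place_heads:
  assumes "length ts = tapes M"
  shows "map (\<lambda>i. fst (place s ts w) (b + i) 0) [0..<tapes M] = map (\<lambda>t. t 0) ts"
  using assms by (intro nth_equalityI) (auto simp: place_def)

text \<open>Steps correspond one to one, which transfers time bounds as well as results. Only the
  passage from an accepting halt to \<open>Skip\<close> is additional, and transitions with a
  mismatched letter have no counterpart.\<close>

lemma cstep_Run:
  assumes "valid (q, ts, u, w)" and "matches s w"
  shows "cstep (Run q, place s ts w) y \<longleftrightarrow>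
    (\<exists>q' ts' u' w'. step M {} (q, ts, u, w) (q', ts', u', w') \<and> matches s w' \<and>
       y = (Run q', place s ts' w')) \<or>
    (\<nexists>c. step M {} (q, ts, u, w) c) \<and> q \<in> accepting M \<and> y = (Skip, place s ts w)"
    (is "?lhs \<longleftrightarrow> ?rhs")
proof -
  obtain \<tau> u2 v2 where p: "place s ts w = (\<tau>, u2, v2)" by (metis surj_pair)
  let ?D = "delta M q (map (\<lambda>t. t 0) ts)"
  have l: "length ts = tapes M" using assms(1) by simp
  have heads: "map (\<lambda>i. \<tau> (b + i) 0) [0..<tapes M] = map (\<lambda>t. t 0) ts"
    using place_heads[OF l, of s w] p by simp
  have m: "matches s (w @ emit e) \<longleftrightarrow> (\<forall>j c. md = Compare j \<longrightarrow> e = Some c \<longrightarrow> \<tau> j 0 = letter c)" for e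
    using matches_emit[of s w e ts] assms(2) unfolding p fst_conv by blast
  define acts where "acts ws e = (\<lambda>i. if b \<le> i \<and> i < b + tapes M then ws ! (i - b)
       else if md = Compare i \<and> e \<noteq> None then (\<tau> i 0, Right) else hold (\<lambda>i. \<tau> i 0) i)"
    for ws :: "(nat \<times> move) list" and e :: "bool option"
  let ?q = "\<lambda>e. if md = Query then e else None" and ?o = "\<lambda>e. if md = Out then e else None"
  have cdelta: "d \<in> cdelta (Run q) (\<lambda>i. \<tau> i 0) \<longleftrightarrow>
      (\<exists>q' ws a e. d = (Run q', acts ws e, ?q e, ?o e) \<and> (q', ws, a, e) \<in> ?D \<and> q' \<in> states M \<and>
         matches s (w @ emit e)) \<or>
      ?D = {} \<and> q \<in> accepting M \<and> d = (Skip, hold (\<lambda>i. \<tau> i 0), None, None)" for d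
    unfolding cdelta.simps heads m acts_def[symmetric] Un_iff mem_Collect_eq
    by (cases "?D = {} \<and> q \<in> accepting M") (simp_all only: if_True if_False singleton_iff empty_iff simp_thms conj_assoc[symmetric])
  have place': "((\<lambda>i. write_move (acts ws e i) (\<tau> i)), u2 @ emit (?q e), v2 @ emit (?o e)) =
      place s (map2 write_move ws ts) (w @ emit e)" if "length ws = tapes M" for ws e
    unfolding acts_def by (rule place_step[OF l that p])
  show ?thesis
  proof
    assume ?lhs
    then obtain c' f x z where d: "(c', f, x, z) \<in> cdelta (Run q) (\<lambda>i. \<tau> i 0)"
      and y: "y = (c', \<lambda>i. write_move (f i) (\<tau> i), u2 @ emit x, v2 @ emit z)"
      unfolding p cstep_iff by blast
    from d[unfolded cdelta] show ?rhs
    proof (elim disjE exE conjE)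
      fix q' ws a e
      assume *: "(c', f, x, z) = (Run q', acts ws e, ?q e, ?o e)" "(q', ws, a, e) \<in> ?D"
        "matches s (w @ emit e)"
      have "y = (Run q', place s (map2 write_move ws ts) (w @ emit e))"
        unfolding place'[OF delta_M(2)[OF assms(1) *(2)], symmetric] using *(1) y by simp
      moreover have "step M {} (q, ts, u, w) (q', map2 write_move ws ts, u @ emit a, w @ emit e)"
        using *(2) M_step_iff by blast
      ultimately show ?thesis using *(3) by blast
    next
      assume *: "?D = {}" "q \<in> accepting M" "(c', f, x, z) = (Skip, hold (\<lambda>i. \<tau> i 0), None, None)"
      then have "y = (Skip, place s ts w)" using y p by simp
      then show ?thesis using * by (simp add: M_step_iff)
    qed
  next
    assume ?rhs
    then show ?lhs
    proof (elim disjE exE conjE)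
      fix q' ts' u' w'
      assume *: "step M {} (q, ts, u, w) (q', ts', u', w')" "matches s w'" "y = (Run q', place s ts' w')"
      then obtain ws a e where d: "(q', ws, a, e) \<in> ?D" "ts' = map2 write_move ws ts" "w' = w @ emit e"
        unfolding M_step_iff by blast
      then have "(Run q', acts ws e, ?q e, ?o e) \<in> cdelta (Run q) (\<lambda>i. \<tau> i 0)"
        using delta_M(1)[OF assms(1)] *(2) unfolding cdelta by blast
      from cstepI[OF this, where \<tau> = \<tau> and u = u2 and v = v2, OF refl refl] show ?thesis
        unfolding p *(3) d(2,3) place'[OF delta_M(2)[OF assms(1) d(1)]] .
    next
      assume *: "\<nexists>c. step M {} (q, ts, u, w) c" "q \<in> accepting M" "y = (Skip, place s ts w)"
      have "?D = {}"
      proof (rule ccontr)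
        assume "?D \<noteq> {}"
        then obtain q' ws a e where "(q', ws, a, e) \<in> ?D"
          by (metis all_not_in_conv surj_pair)
        then show False using *(1) M_step_iff by blast
      qed
      then have "(Skip, hold (\<lambda>i. \<tau> i 0), None, None) \<in> cdelta (Run q) (\<lambda>i. \<tau> i 0)"
        using *(2) unfolding cdelta by blast
      from cstepI[OF this, where \<tau> = \<tau> and u = u2 and v = v2, OF refl refl] show ?thesis
        unfolding *(3) p by simp
    qed
  qed
qed

lemma M_output_grows:
  assumes "step M A (q, ts, u, w) (q', ts', u', w')"
  shows "\<exists>e. w' = w @ e"
  using assms by (auto simp: M_step_iff)

lemma valid_steps:
  assumes "(step M A ^^ k) x y" and "valid x"
  shows "valid y"
  using assms(1)
proof (induction k arbitrary: y)
  case (Suc k)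
  from Suc.prems obtain z where "(step M A ^^ k) x z" "step M A z y"
    by (rule relpowp_Suc_E)
  then show ?case using Suc.IH valid_step by blast
qed (use assms(2) in simp)

lemma Run_steps:
  assumes "(cstep ^^ k) (Run q, place s ts w) y" and "valid (q, ts, u, w)" and "matches s w"
  shows "(\<exists>q' ts' u' w'. (step M {} ^^ k) (q, ts, u, w) (q', ts', u', w') \<and> matches s w' \<and>
       y = (Run q', place s ts' w')) \<or>
    (\<exists>j q' ts' u' w'. k = Suc j \<and> (step M {} ^^ j) (q, ts, u, w) (q', ts', u', w') \<and>
       matches s w' \<and> (\<nexists>c. step M {} (q', ts', u', w') c) \<and> q' \<in> accepting M \<and>
       y = (Skip, place s ts' w'))"
  using assms(1)
proof (induction k arbitrary: y)
  case 0
  then show ?case using assms(3) by auto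
next
  case (Suc k)
  from Suc.prems obtain z where z: "(cstep ^^ k) (Run q, place s ts w) z" "cstep z y" by auto
  have "\<exists>q' ts' u' w'. (step M {} ^^ k) (q, ts, u, w) (q', ts', u', w') \<and> matches s w' \<and>
       z = (Run q', place s ts' w')"
    using Suc.IH[OF z(1)] z(2) by auto
  then obtain q' ts' u' w' where
    *: "(step M {} ^^ k) (q, ts, u, w) (q', ts', u', w')" "matches s w'" "z = (Run q', place s ts' w')"
    by blast
  from cstep_Run[OF valid_steps[OF *(1) assms(2)] *(2), of y] z(2) *(3)
  consider q2 ts2 u2 w2 where "step M {} (q', ts', u', w') (q2, ts2, u2, w2)" "matches s w2"
      "y = (Run q2, place s ts2 w2)"
    | "\<nexists>c. step M {} (q', ts', u', w') c" "q' \<in> accepting M" "y = (Skip, place s ts' w')"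
    by metis
  then show ?case
  proof cases
    case 1
    then have "(step M {} ^^ Suc k) (q, ts, u, w) (q2, ts2, u2, w2)" using *(1) by auto
    then show ?thesis using 1 by blast
  next
    case 2
    then show ?thesis using * by blast
  qed
qed

text \<open>\<open>matches\<close> is assumed at the end only: output is never erased, so all
  earlier outputs are prefixes of \<open>w'\<close> and match as well.\<close>

lemma Run_complete:
  assumes "(step M {} ^^ k) (q, ts, u, w) (q', ts', u', w')" and "valid (q, ts, u, w)"
    and "matches s w'"
  shows "(cstep ^^ k) (Run q, place s ts w) (Run q', place s ts' w')"
  using assms(1,3)
proof (induction k arbitrary: q' ts' u' w')
  case (Suc k)
  from Suc.prems(1) obtain q2 ts2 u2 w2 where
    *: "(step M {} ^^ k) (q, ts, u, w) (q2, ts2, u2, w2)" "step M {} (q2, ts2, u2, w2) (q', ts', u', w')"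
    by (elim relpowp_Suc_E) (metis surj_pair)
  have m: "matches s w2"
    using M_output_grows[OF *(2)] Suc.prems(2) matches_append by blast
  have "cstep (Run q2, place s ts2 w2) (Run q', place s ts' w')"
    using cstep_Run[OF valid_steps[OF *(1) assms(2)] m] *(2) Suc.prems(2) by blast
  then show ?case using Suc.IH[OF *(1) m] by auto
qed simp

definition final :: "word list \<Rightarrow> tape list \<Rightarrow> word \<Rightarrow> bool" where
  "final xs ts w \<longleftrightarrow> (\<exists>q u. (step M {})\<^sup>*\<^sup>* (init M xs) (q, ts, u, w) \<and>
     (\<nexists>c. step M {} (q, ts, u, w) c) \<and> q \<in> accepting M)"

lemma outputs_final: "outputs M {} xs = {w. \<exists>ts. final xs ts w}"
  by (auto simp: outputs_def final_def)

text \<open>The bound on all paths of \<open>M\<close> also covers runs that reject or are cut off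
  by a mismatch, while the final stores come from accepting paths. The additional step leads from
  the accepting halt to \<open>Skip\<close>.\<close>

lemma exec_Run:
  assumes input: "\<And>i. i < tapes M \<Longrightarrow>
      \<tau> (b + i) = (if i < length xs then word_tape (xs ! i) else word_tape [])"
    and time: "\<And>k c. (step M {} ^^ k) (init M xs) c \<Longrightarrow> k \<le> T"
  shows "exec (Run (start M)) (\<tau>, u, v)
    {place (\<tau>, u, v) ts w | ts w. final xs ts w \<and> matches (\<tau>, u, v) w} (Suc T)"
proof -
  obtain ts0 where i: "init M xs = (start M, ts0, [], [])" by (simp add: init_def)
  have ts0: "ts0 = map (\<lambda>i. if i < length xs then word_tape (xs ! i) else word_tape []) [0..<tapes M]"
    using i by (simp add: init_def)
  have s: "place (\<tau>, u, v) ts0 [] = (\<tau>, u, v)"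
  proof -
    have "ts0 ! (i - b) = \<tau> i" if "b \<le> i" "i < b + tapes M" for i
      using input[of "i - b"] that by (simp add: ts0)
    then show ?thesis by (auto simp: place_def)
  qed
  have valid: "valid (start M, ts0, [], [])" using valid_init[of xs] i by simp
  show ?thesis
  proof (rule execI)
    fix r
    show "cstep\<^sup>*\<^sup>* (Run (start M), \<tau>, u, v) (Skip, r) \<longleftrightarrow>
      r \<in> {place (\<tau>, u, v) ts w | ts w. final xs ts w \<and> matches (\<tau>, u, v) w}"
    proof
      assume "cstep\<^sup>*\<^sup>* (Run (start M), \<tau>, u, v) (Skip, r)"
      then obtain k where "(cstep ^^ k) (Run (start M), place (\<tau>, u, v) ts0 []) (Skip, r)"
        unfolding s by (blast dest: rtranclp_imp_relpowp)
      from Run_steps[OF this valid matches_Nil] obtain j q ts u' w where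
        *: "(step M {} ^^ j) (start M, ts0, [], []) (q, ts, u', w)" "matches (\<tau>, u, v) w"
        "\<nexists>c. step M {} (q, ts, u', w) c" "q \<in> accepting M" "r = place (\<tau>, u, v) ts w"
        by blast
      then have "final xs ts w"
        unfolding final_def i by (intro exI[of _ q] exI[of _ u']) (simp add: relpowp_imp_rtranclp)
      with * show "r \<in> {place (\<tau>, u, v) ts w | ts w. final xs ts w \<and> matches (\<tau>, u, v) w}"
        by blast
    next
      assume "r \<in> {place (\<tau>, u, v) ts w | ts w. final xs ts w \<and> matches (\<tau>, u, v) w}"
      then obtain ts w q u' where r: "r = place (\<tau>, u, v) ts w" "matches (\<tau>, u, v) w"
        "(step M {})\<^sup>*\<^sup>* (start M, ts0, [], []) (q, ts, u', w)"
        "\<nexists>c. step M {} (q, ts, u', w) c" "q \<in> accepting M"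
        unfolding final_def i by blast
      from r(3) obtain k where k: "(step M {} ^^ k) (start M, ts0, [], []) (q, ts, u', w)"
        by (blast dest: rtranclp_imp_relpowp)
      have "cstep\<^sup>*\<^sup>* (Run (start M), \<tau>, u, v) (Run q, place (\<tau>, u, v) ts w)"
        using Run_complete[OF k valid r(2)] unfolding s by (rule relpowp_imp_rtranclp)
      moreover have "cstep (Run q, place (\<tau>, u, v) ts w) (Skip, place (\<tau>, u, v) ts w)"
        using cstep_Run[OF valid_steps[OF k valid] r(2)] r(4,5) by blast
      ultimately show "cstep\<^sup>*\<^sup>* (Run (start M), \<tau>, u, v) (Skip, r)"
        unfolding r(1) by (rule rtranclp.rtrancl_into_rtrancl)
    qed
  next
    fix k y
    assume "(cstep ^^ k) (Run (start M), \<tau>, u, v) y"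
    then have "(cstep ^^ k) (Run (start M), place (\<tau>, u, v) ts0 []) y" unfolding s .
    from Run_steps[OF this valid matches_Nil] show "k \<le> Suc T"
      using time unfolding i by (auto intro: le_SucI)
  qed
qed

section \<open>Compiling programs to machines\<close>

text \<open>A finite syntactic superset of the programs reachable by \<open>cstep\<close>;
  \<open>Run q\<close> contributes \<open>Run\<close> of every state of \<open>M\<close>, whether
  reachable or not.\<close>

primrec residuals :: "com \<Rightarrow> com set" where
  "residuals Skip = {Skip}"
| "residuals (Op ts s d) = {Op ts s d, Skip}"
| "residuals (Cpy i j) = {Cpy i j, Skip}"
| "residuals (Chk i S) = {Chk i S, Skip}"
| "residuals (Guess j) = {Guess j, Skip}"
| "residuals (Run q) = insert Skip (Run ` states M)"
| "residuals (While i S c) = {While i S c, Skip} \<union> (\<lambda>x. x ;; While i S c) ` residuals c"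
| "residuals (c ;; d) = (\<lambda>x. x ;; d) ` residuals c \<union> residuals d"

text \<open>Bounds the tapes that a program changes or moves, and restricts written symbols to the
  three that every alphabet contains. A test of a tape from \<open>K\<close> on reads a blank, both
  in the compiled machine and in a \<open>proper\<close> store.\<close>

primrec fits :: "nat \<Rightarrow> com \<Rightarrow> bool" where
  "fits K Skip \<longleftrightarrow> True"
| "fits K (Op ts s d) \<longleftrightarrow> (\<forall>i \<in> set ts. i < K) \<and> (\<forall>a. s = Some a \<longrightarrow> a \<in> {0, 1, 2})"
| "fits K (Cpy i j) \<longleftrightarrow> i < K \<and> j < K"
| "fits K (Chk i S) \<longleftrightarrow> True"
| "fits K (Guess j) \<longleftrightarrow> j < K"
| "fits K (Run q) \<longleftrightarrow> q \<in> states M \<and> b + tapes M \<le> K \<and> (\<forall>j. md = Compare j \<longrightarrow> j < K)"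
| "fits K (While i S c) \<longleftrightarrow> fits K c"
| "fits K (c ;; d) \<longleftrightarrow> fits K c \<and> fits K d"

primrec guess_free :: "com \<Rightarrow> bool" where
  "guess_free Skip \<longleftrightarrow> True"
| "guess_free (Op ts s d) \<longleftrightarrow> True"
| "guess_free (Cpy i j) \<longleftrightarrow> True"
| "guess_free (Chk i S) \<longleftrightarrow> True"
| "guess_free (Guess j) \<longleftrightarrow> False"
| "guess_free (Run q) \<longleftrightarrow> True"
| "guess_free (While i S c) \<longleftrightarrow> guess_free c"
| "guess_free (c ;; d) \<longleftrightarrow> guess_free c \<and> guess_free d"

lemma finite_residuals: "finite (residuals c)"
  using wf by (induction c) (auto simp: well_formed_def)

lemma residuals_refl: "fits K c \<Longrightarrow> c \<in> residuals c"
  by (induction c) auto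

lemma residuals_trans: "c' \<in> residuals c \<Longrightarrow> residuals c' \<subseteq> residuals c"
  by (induction c arbitrary: c') force+

lemma residuals_fits:
  assumes "fits K c" "c' \<in> residuals c"
  shows "fits K c'"
proof -
  have "fits K c \<Longrightarrow> residuals c \<subseteq> Collect (fits K)"
    by (induction c) auto
  then show ?thesis using assms by blast
qed

lemma residuals_guess_free:
  assumes "guess_free c" "c' \<in> residuals c"
  shows "guess_free c'"
proof -
  have "guess_free c \<Longrightarrow> residuals c \<subseteq> Collect guess_free"
    by (induction c) auto
  then show ?thesis using assms by blast
qed

lemma cdelta_residuals:
  "fits K c \<Longrightarrow> (c', acts, a, e) \<in> cdelta c h \<Longrightarrow> c' \<in> residuals c"
  by (induction c arbitrary: c' acts a e) (auto simp: residuals_refl split: if_splits)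

lemma cdelta_hold:
  "fits K c \<Longrightarrow> (c', acts, a, e) \<in> cdelta c h \<Longrightarrow> K \<le> i \<Longrightarrow> acts i = hold h i"
  by (induction c arbitrary: c' acts a e) (auto split: if_splits)

lemma letter_symbols: "letter c \<in> symbols M"
  using symbols_M by (simp add: letter_def)

lemma delta_Run:
  assumes "q \<in> states M" "\<And>i. i < K \<Longrightarrow> h i \<in> symbols M" "b + tapes M \<le> K"
    and "(q', ws, a, e) \<in> delta M q (map (\<lambda>i. h (b + i)) [0..<tapes M])"
  shows "length ws = tapes M" "fst ` set ws \<subseteq> symbols M"
proof -
  \<comment> \<open>Constant tapes that show the given heads, so that \<open>delta_M\<close>, which
    speaks of configurations, applies.\<close>
  let ?ts = "map (\<lambda>i. (\<lambda>k :: int. h (b + i))) [0..<tapes M]"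
  have "valid (q, ?ts, [], [])" using assms(1-3) by auto
  moreover have "map (\<lambda>t. t 0) ?ts = map (\<lambda>i. h (b + i)) [0..<tapes M]" by simp
  ultimately show "length ws = tapes M" "fst ` set ws \<subseteq> symbols M"
    using delta_M assms(4) by metis+
qed

lemma cdelta_symbols:
  assumes "fits K c" "(c', acts, a, e) \<in> cdelta c h"
    and h: "\<And>i. i < K \<Longrightarrow> h i \<in> symbols M" and i: "i < K"
  shows "fst (acts i) \<in> symbols M"
  using assms(1,2)
proof (induction c arbitrary: c' acts a e)
  case (Run q)
  from Run.prems(2) consider "acts = hold h"
    | q' ws a' e' where "(q', ws, a', e') \<in> delta M q (map (\<lambda>i. h (b + i)) [0..<tapes M])"
      "acts = (\<lambda>i. if b \<le> i \<and> i < b + tapes M then ws ! (i - b)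
           else if md = Compare i \<and> e' \<noteq> None then (h i, Right) else hold h i)"
    by (simp only: cdelta.simps Un_iff mem_Collect_eq prod.inject) (metis (no_types, lifting) empty_iff prod.inject singletonD)
  then show ?case
  proof cases
    case (2 q' ws a' e')
    have ws: "length ws = tapes M" "fst ` set ws \<subseteq> symbols M"
      using delta_Run[OF _ h _ 2(1)] Run.prems(1) by simp_all
    have "fst (ws ! (i - b)) \<in> symbols M" if "b \<le> i" "i < b + tapes M"
    proof -
      have "ws ! (i - b) \<in> set ws" using ws(1) that by simp
      then show ?thesis using ws(2) by blast
    qed
    then show ?thesis using h[OF i] by (simp add: 2(2) hold_def)
  qed (use h[OF i] in \<open>simp add: hold_def\<close>)
qed (use h i symbols_M letter_symbols in \<open>auto simp: hold_def split: if_splits option.splits\<close>)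

text \<open>\<open>Guess\<close> is the only command that branches on its own. For
  \<open>Run\<close>, leaving requires that \<open>M\<close> has no transition, so exit and
  transition exclude each other.\<close>

lemma cdelta_deterministic:
  assumes "fits K c" "guess_free c" "deterministic M"
    and h: "\<And>i. i < K \<Longrightarrow> h i \<in> symbols M"
    and "x \<in> cdelta c h" "y \<in> cdelta c h"
  shows "x = y"
  using assms(1,2,5,6)
proof (induction c arbitrary: x y)
  case (Run q)
  let ?ss = "map (\<lambda>i. h (b + i)) [0..<tapes M]"
  have "q \<in> states M" "length ?ss = tapes M" "set ?ss \<subseteq> symbols M"
    using Run.prems(1) h by auto
  then have "\<forall>r \<in> delta M q ?ss. \<forall>s \<in> delta M q ?ss. r = s"
    using assms(3) unfolding deterministic_def by meson
  then show ?case
    using Run.prems(3,4) unfolding cdelta.simps by (auto split: if_splits; force)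
next
  case (Seq c d)
  show ?case
  proof (cases "c = Skip")
    case False
    then obtain x1 x2 x3 x4 y1 y2 y3 y4 where
      x: "x = (x1 ;; d, x2, x3, x4)" "(x1, x2, x3, x4) \<in> cdelta c h" and
      y: "y = (y1 ;; d, y2, y3, y4)" "(y1, y2, y3, y4) \<in> cdelta c h"
      using Seq.prems(3,4) by auto
    have "(x1, x2, x3, x4) = (y1, y2, y3, y4)"
      using Seq.IH(1)[OF _ _ x(2) y(2)] Seq.prems(1,2) by simp
    then show ?thesis using x y by simp
  qed (use Seq.prems in simp)
qed (auto split: if_splits)

text \<open>
  The program runs on tapes \<open>0, \<dots>, K - 1\<close>.  With \<open>orc\<close>, the machine queries its oracle when the
  program is finished and accepts in the state \<open>Chk 1 []\<close> if the answer is yes.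
\<close>
definition compile :: "nat \<Rightarrow> com \<Rightarrow> bool \<Rightarrow> machine" where
  "compile K c orc =
     \<lparr>states = to_nat ` (residuals c \<union> {Skip, Chk 0 [], Chk 1 []}),
      symbols = symbols M,
      tapes = K,
      start = to_nat c,
      accepting = {to_nat (if orc then Chk 1 [] else Skip)},
      delta = (\<lambda>q ss. {(to_nat c', map acts [0..<K], a, e) | c' acts a e.
        (c', acts, a, e) \<in> cdelta (from_nat q) (\<lambda>i. if i < K then ss ! i else 0)}),
      query_states = if orc then Some (to_nat Skip, to_nat (Chk 1 []), to_nat (Chk 0 [])) else None\<rparr>"

lemma compile_simps:
  "states (compile K c orc) = to_nat ` (residuals c \<union> {Skip, Chk 0 [], Chk 1 []})"
  "symbols (compile K c orc) = symbols M" "tapes (compile K c orc) = K"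
  "start (compile K c orc) = to_nat c"
  "accepting (compile K c orc) = {to_nat (if orc then Chk 1 [] else Skip)}"
  "query_states (compile K c orc) =
     (if orc then Some (to_nat Skip, to_nat (Chk 1 []), to_nat (Chk 0 [])) else None)"
  by (simp_all add: compile_def)

lemma compile_delta:
  "(q', ws, a, e) \<in> delta (compile K c orc) (to_nat d) ss \<longleftrightarrow>
   (\<exists>c' acts. q' = to_nat c' \<and> ws = map acts [0..<K] \<and>
      (c', acts, a, e) \<in> cdelta d (\<lambda>i. if i < K then ss ! i else 0))"
  by (auto simp: compile_def)

lemma compile_well_formed:
  assumes "fits K c" "1 \<le> K"
  shows "well_formed (compile K c orc)"
proof -
  let ?M = "compile K c orc"
  have closed: "q' \<in> states (compile K c orc) \<and> length ws = K \<and> fst ` set ws \<subseteq> symbols M"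
    if q: "q \<in> states (compile K c orc)" and ss: "length ss = K" "set ss \<subseteq> symbols M"
      and d: "(q', ws, a, e) \<in> delta (compile K c orc) q ss" for q ss q' ws a e
  proof -
    let ?h = "\<lambda>i. if i < K then ss ! i else 0"
    from d obtain c' acts where c': "q' = to_nat c'" "ws = map acts [0..<K]"
      "(c', acts, a, e) \<in> cdelta (from_nat q) ?h"
      by (auto simp: compile_def)
    from q obtain d where d: "d = from_nat q" "d \<in> residuals c \<union> {Skip, Chk 0 [], Chk 1 []}"
      by (auto simp: compile_def)
    \<comment> \<open>The three states added to the residuals have no transitions.\<close>
    have d': "d \<in> residuals c" using c'(3) d by auto
    have fits: "fits K d" using residuals_fits[OF assms(1) d'] .
    have "c' \<in> residuals c"
      using cdelta_residuals[OF fits] c'(3) d(1) residuals_trans[OF d'] by blast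
    moreover have "fst (acts i) \<in> symbols M" if "i < K" for i
      using cdelta_symbols[OF fits c'(3)[folded d(1)] _ that] ss by (auto simp: subset_iff)
    ultimately show ?thesis using c' by (auto simp: compile_def)
  qed
  have "\<forall>q \<in> states ?M. \<forall>ss. length ss = tapes ?M \<and> set ss \<subseteq> symbols ?M \<longrightarrow>
      (\<forall>(q', ws, a, b) \<in> delta ?M q ss.
        q' \<in> states ?M \<and> length ws = tapes ?M \<and> fst ` set ws \<subseteq> symbols ?M)"
  proof (intro ballI allI impI)
    fix q ss x
    assume *: "q \<in> states ?M" "length ss = tapes ?M \<and> set ss \<subseteq> symbols ?M" "x \<in> delta ?M q ss"
    obtain q' ws a e where x: "x = (q', ws, a, e)" by (metis surj_pair)
    have "q' \<in> states ?M \<and> length ws = K \<and> fst ` set ws \<subseteq> symbols M"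
      by (rule closed[of q ss q' ws a e]) (use * x in \<open>simp_all only: compile_simps(2,3)\<close>)
    then show "case x of (q', ws, a, b) \<Rightarrow>
        q' \<in> states ?M \<and> length ws = tapes ?M \<and> fst ` set ws \<subseteq> symbols ?M"
      using x by (simp only: compile_simps(2,3) prod.case)
  qed
  moreover have "c \<in> residuals c" "finite (residuals c)"
    using residuals_refl[OF assms(1)] finite_residuals by auto
  ultimately show ?thesis
    unfolding well_formed_def using assms(2) symbols_M by (simp add: compile_simps)
qed

lemma compile_deterministic:
  assumes "fits K c" "guess_free c" "deterministic M"
  shows "deterministic (compile K c orc)"
  unfolding deterministic_def
proof (intro ballI allI impI)
  fix q ss r s
  assume q: "q \<in> states (compile K c orc)"
    and ss: "length ss = tapes (compile K c orc) \<and> set ss \<subseteq> symbols (compile K c orc)"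
    and rs: "r \<in> delta (compile K c orc) q ss" "s \<in> delta (compile K c orc) q ss"
  let ?h = "\<lambda>i. if i < K then ss ! i else 0"
  from rs obtain x y where x: "x \<in> cdelta (from_nat q) ?h" "y \<in> cdelta (from_nat q) ?h"
    and r: "r = (to_nat (fst x), map (fst (snd x)) [0..<K], snd (snd x))"
      "s = (to_nat (fst y), map (fst (snd y)) [0..<K], snd (snd y))"
    by (force simp: compile_def)
  from q obtain d where d: "d = from_nat q" "d \<in> residuals c \<union> {Skip, Chk 0 [], Chk 1 []}"
    by (auto simp: compile_def)
  have d': "d \<in> residuals c" using x d by auto
  have "?h i \<in> symbols M" if "i < K" for i
    using that ss by (auto simp: compile_def subset_iff)
  then have "x = y"
    using cdelta_deterministic[OF residuals_fits[OF assms(1) d'] residuals_guess_free[OF assms(2) d']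
        assms(3), of ?h x y] x d(1) by blast
  then show "r = s" using r by simp
qed

section \<open>Correspondence between programs and compiled machines\<close>

fun conf :: "nat \<Rightarrow> com \<times> store \<Rightarrow> config" where
  "conf K (c, \<tau>, u, v) = (to_nat c, map \<tau> [0..<K], u, v)"

text \<open>\<open>conf\<close> drops the tapes from \<open>K\<close> on, and the compiled machine
  reads \<open>0\<close> for them; keeping them blank makes both views agree.\<close>

fun proper :: "nat \<Rightarrow> com \<times> store \<Rightarrow> bool" where
  "proper K (c, \<tau>, u, v) \<longleftrightarrow> fits K c \<and> (\<forall>i \<ge> K. \<tau> i = word_tape [])"

text \<open>Adds the oracle step of the compiled machine: the query is asked once the program has
  reached \<open>Skip\<close>, and \<open>Chk\<close> with an empty list serves as an answer state
  without successors.\<close>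

definition ostep :: "bool \<Rightarrow> word set \<Rightarrow> com \<times> store \<Rightarrow> com \<times> store \<Rightarrow> bool" where
  "ostep orc A x y \<longleftrightarrow> cstep x y \<or>
     (orc \<and> (\<exists>\<tau> u v. x = (Skip, \<tau>, u, v) \<and> y = (if u \<in> A then Chk 1 [] else Chk 0 [], \<tau>, [], v)))"

lemma proper_ostep:
  assumes "proper K x" "ostep orc A x y"
  shows "proper K y"
proof -
  obtain c \<tau> u v where x: "x = (c, \<tau>, u, v)" by (metis surj_pair)
  from assms(2) consider "cstep x y"
    | "y = (if u \<in> A then Chk 1 [] else Chk 0 [], \<tau>, [], v)"
    unfolding ostep_def x by blast
  then show ?thesis
  proof cases
    case 1
    then obtain c' acts a e where d: "(c', acts, a, e) \<in> cdelta c (\<lambda>i. \<tau> i 0)"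
      and y: "y = (c', \<lambda>i. write_move (acts i) (\<tau> i), u @ emit a, v @ emit e)"
      unfolding x cstep_iff by blast
    have c: "fits K c" using assms(1) x by simp
    have "fits K c'" using residuals_fits[OF c cdelta_residuals[OF c d]] .
    moreover have "write_move (acts i) (\<tau> i) = \<tau> i" if "K \<le> i" for i
      using cdelta_hold[OF c d that] by simp
    ultimately show ?thesis using assms(1) x y by simp
  qed (use assms(1) x in auto)
qed

lemma step_conf:
  assumes "proper K x"
  shows "step (compile K c orc) A (conf K x) y \<longleftrightarrow> (\<exists>x'. ostep orc A x x' \<and> y = conf K x')"
proof -
  obtain d \<tau> u v where x: "x = (d, \<tau>, u, v)" by (metis surj_pair)
  let ?h = "\<lambda>i. if i < K then map (\<lambda>t. t 0) (map \<tau> [0..<K]) ! i else 0"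
  have h: "?h = (\<lambda>i. \<tau> i 0)"
    using assms x by (auto simp: word_tape_def)
  have map2: "map2 write_move (map acts [0..<K]) (map \<tau> [0..<K]) =
      map (\<lambda>i. write_move (acts i) (\<tau> i)) [0..<K]" for acts
    by (intro nth_equalityI) auto
  show ?thesis
  proof
    assume "step (compile K c orc) A (conf K x) y"
    then show "\<exists>x'. ostep orc A x x' \<and> y = conf K x'"
    proof (cases rule: step.cases)
      case (transition q q' ws a e ts u' v')
      then have e: "q = to_nat d" "ts = map \<tau> [0..<K]" "u' = u" "v' = v" using x by auto
      from transition(4) obtain c' acts where c': "q' = to_nat c'" "ws = map acts [0..<K]"
        "(c', acts, a, e) \<in> cdelta d ?h"
        unfolding e compile_delta by blast
      have "cstep x (c', \<lambda>i. write_move (acts i) (\<tau> i), u @ emit a, v @ emit e)"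
        using c'(3) unfolding h x cstep_iff by blast
      moreover have "y = conf K (c', \<lambda>i. write_move (acts i) (\<tau> i), u @ emit a, v @ emit e)"
        using transition(2) unfolding c' e map2 by simp
      ultimately show ?thesis unfolding ostep_def by blast
    next
      case (query q yes no ts u' v')
      then have "orc" "d = Skip" and e: "q = to_nat d" "ts = map \<tau> [0..<K]" "u' = u" "v' = v"
        "yes = to_nat (Chk 1 [])" "no = to_nat (Chk 0 [])"
        using x by (auto simp: compile_def split: if_splits)
      then have "ostep orc A x (if u \<in> A then Chk 1 [] else Chk 0 [], \<tau>, [], v)"
        unfolding ostep_def x by blast
      moreover have "y = conf K (if u \<in> A then Chk 1 [] else Chk 0 [], \<tau>, [], v)"
        using query(2) unfolding e by simp
      ultimately show ?thesis by blast
    qed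
  next
    assume "\<exists>x'. ostep orc A x x' \<and> y = conf K x'"
    then obtain x' where x': "ostep orc A x x'" "y = conf K x'" by blast
    from x'(1) consider "cstep x x'"
      | "orc" "d = Skip" "x' = (if u \<in> A then Chk 1 [] else Chk 0 [], \<tau>, [], v)"
      unfolding ostep_def x by blast
    then show "step (compile K c orc) A (conf K x) y"
    proof cases
      case 1
      then obtain c' acts a e where d: "(c', acts, a, e) \<in> cdelta d ?h"
        and c': "x' = (c', \<lambda>i. write_move (acts i) (\<tau> i), u @ emit a, v @ emit e)"
        unfolding x cstep_iff h by blast
      have "d \<noteq> Skip" using d by auto
      then have "query_states (compile K c orc) \<noteq> Some (to_nat d, yes, no)" for yes no
        by (auto simp: compile_simps)
      moreover have "(to_nat c', map acts [0..<K], a, e) \<in>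
          delta (compile K c orc) (to_nat d) (map (\<lambda>t. t 0) (map \<tau> [0..<K]))"
        using d unfolding compile_delta by blast
      ultimately show ?thesis
        using step.transition[of "compile K c orc" "to_nat d" "to_nat c'" "map acts [0..<K]" a e
            "map \<tau> [0..<K]" A u v]
        unfolding x'(2) c' x conf.simps map2 by blast
    next
      case 2
      then have "query_states (compile K c orc) = Some (to_nat d, to_nat (Chk 1 []), to_nat (Chk 0 []))"
        by (simp add: compile_def)
      from step.query[OF this, of A "map \<tau> [0..<K]" u v] show ?thesis
        unfolding x'(2) 2(3) x by (simp split: if_splits)
    qed
  qed
qed

lemma steps_conf:
  assumes "proper K x"
  shows "(step (compile K c orc) A ^^ k) (conf K x) y \<longleftrightarrow>
    (\<exists>x'. (ostep orc A ^^ k) x x' \<and> y = conf K x')"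
  using assms
proof (induction k arbitrary: x)
  case (Suc k)
  have "(step (compile K c orc) A ^^ Suc k) (conf K x) y \<longleftrightarrow>
    (\<exists>z. step (compile K c orc) A (conf K x) z \<and> (step (compile K c orc) A ^^ k) z y)"
    by (blast intro: relpowp_Suc_I2 dest: relpowp_Suc_D2)
  also have "\<dots> \<longleftrightarrow> (\<exists>z. ostep orc A x z \<and> (step (compile K c orc) A ^^ k) (conf K z) y)"
    unfolding step_conf[OF Suc.prems] by blast
  also have "\<dots> \<longleftrightarrow> (\<exists>z x'. ostep orc A x z \<and> (ostep orc A ^^ k) z x' \<and> y = conf K x')"
    using Suc.IH proper_ostep[OF Suc.prems] by blast
  also have "\<dots> \<longleftrightarrow> (\<exists>x'. (ostep orc A ^^ Suc k) x x' \<and> y = conf K x')"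
    by (blast intro: relpowp_Suc_I2 dest: relpowp_Suc_D2)
  finally show ?case .
qed auto

text \<open>Neither answer state has a successor, so a run contains at most one query, as its last
  step.\<close>

lemma osteps_decompose:
  assumes "(ostep orc A ^^ k) x y"
  shows "(cstep ^^ k) x y \<or> (\<exists>j \<tau> u v. k = Suc j \<and> orc \<and> (cstep ^^ j) x (Skip, \<tau>, u, v) \<and>
    y = (if u \<in> A then Chk 1 [] else Chk 0 [], \<tau>, [], v))"
  using assms
proof (induction k arbitrary: y)
  case (Suc k)
  from Suc.prems obtain z where z: "(ostep orc A ^^ k) x z" "ostep orc A z y"
    by (rule relpowp_Suc_E)
  have stuck: "\<not> ostep orc A (Chk i [], s) y" for i s
    by (cases s) (auto simp: ostep_def cstep_Chk)
  from Suc.IH[OF z(1)] z(2) stuck have k: "(cstep ^^ k) x z"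
    by (auto split: if_splits)
  from z(2) show ?case
    unfolding ostep_def
  proof
    assume "cstep z y"
    with k show ?thesis by (blast intro: relpowp_Suc_I)
  qed (use k in blast)
qed simp

definition input :: "word \<Rightarrow> store" where
  "input x = (\<lambda>i. if i = 0 then word_tape x else word_tape [], [], [])"

lemma conf_init:
  assumes "1 \<le> K"
  shows "init (compile K c orc) [x] = conf K (c, input x)"
  using assms by (auto simp: init_def compile_def input_def)

lemma compile_time:
  assumes "fits K c" "1 \<le> K" and c: "exec c (input x) Z T"
    and k: "(step (compile K c orc) A ^^ k) (init (compile K c orc) [x]) y"
  shows "k \<le> Suc T"
proof -
  have "proper K (c, input x)" using assms(1,2) by (simp add: input_def)
  from k[unfolded conf_init[OF assms(2)] steps_conf[OF this]] obtain z where
    "(ostep orc A ^^ k) (c, input x) z" by blast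
  from osteps_decompose[OF this] show ?thesis
    by (elim disjE exE conjE) (drule exec_time[OF c]; simp)+
qed

lemma compile_reachable:
  assumes "fits K c" "1 \<le> K"
  shows "outputs (compile K c orc) A [x] = {v. \<exists>\<tau> u. (ostep orc A)\<^sup>*\<^sup>* (c, input x)
    ((if orc then Chk 1 [] else Skip), \<tau>, u, v)}"
proof -
  let ?M = "compile K c orc" and ?h = "if orc then Chk 1 [] else Skip"
  have p: "proper K (c, input x)" using assms(1,2) by (simp add: input_def)
  have proper: "proper K y" if "(ostep orc A)\<^sup>*\<^sup>* (c, input x) y" for y
    using that by induction (use p proper_ostep in blast)+
  have reach: "(step ?M A)\<^sup>*\<^sup>* (init ?M [x]) y \<longleftrightarrow>
      (\<exists>z. (ostep orc A)\<^sup>*\<^sup>* (c, input x) z \<and> y = conf K z)" for y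
    unfolding conf_init[OF assms(2)] rtranclp_power steps_conf[OF p] by blast
  have halt: "\<nexists>y. step ?M A (conf K (?h, s)) y" if "proper K (?h, s)" for s
    unfolding step_conf[OF that] by (cases s) (auto simp: ostep_def cstep_Chk)
  have accepting: "accepting ?M = {to_nat ?h}" by (simp add: compile_def)
  show ?thesis
  proof (intro set_eqI iffI)
    fix v
    assume "v \<in> outputs ?M A [x]"
    then obtain q ts u where "(step ?M A)\<^sup>*\<^sup>* (init ?M [x]) (q, ts, u, v)" "q = to_nat ?h"
      unfolding outputs_def accepting by blast
    then obtain d \<tau> u' v' where z: "(ostep orc A)\<^sup>*\<^sup>* (c, input x) (d, \<tau>, u', v')"
      "(to_nat ?h, ts, u, v) = conf K (d, \<tau>, u', v')"
      unfolding reach by (metis surj_pair)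
    then have "d = ?h" "v' = v" by (simp_all split: if_splits)
    with z(1) show "v \<in> {v. \<exists>\<tau> u. (ostep orc A)\<^sup>*\<^sup>* (c, input x) (?h, \<tau>, u, v)}"
      by blast
  next
    fix v
    assume "v \<in> {v. \<exists>\<tau> u. (ostep orc A)\<^sup>*\<^sup>* (c, input x) (?h, \<tau>, u, v)}"
    then obtain \<tau> u where *: "(ostep orc A)\<^sup>*\<^sup>* (c, input x) (?h, \<tau>, u, v)" by blast
    then have "(step ?M A)\<^sup>*\<^sup>* (init ?M [x]) (conf K (?h, \<tau>, u, v))"
      unfolding reach by blast
    with halt[OF proper[OF *]] show "v \<in> outputs ?M A [x]"
      unfolding outputs_def accepting conf.simps by blast
  qed
qed

lemma compile_outputs:
  assumes "fits K c" "1 \<le> K" and c: "exec c (input x) Z T"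
  shows "outputs (compile K c False) A [x] = {v. \<exists>\<tau> u. (\<tau>, u, v) \<in> Z}"
proof -
  have "ostep False A = cstep" by (auto simp: ostep_def fun_eq_iff)
  then show ?thesis
    using exec_final[OF c] unfolding compile_reachable[OF assms(1,2)] by simp
qed

text \<open>The side condition keeps the accepting state \<open>Chk 1 []\<close> out of the
  program's own states, so that it is entered only through a positive answer.\<close>

lemma compile_oracle:
  assumes "fits K c" "1 \<le> K" and c: "exec c (input x) Z T" and "Chk 1 [] \<notin> residuals c"
  shows "outputs (compile K c True) A [x] \<noteq> {} \<longleftrightarrow> (\<exists>\<tau> u v. (\<tau>, u, v) \<in> Z \<and> u \<in> A)"
proof -
  have cstep_res: "fst y \<in> residuals c" if "(cstep ^^ k) (c, input x) y" for k y
    using that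
  proof (induction k arbitrary: y)
    case (Suc k)
    from Suc.prems obtain z where z: "(cstep ^^ k) (c, input x) z" "cstep z y"
      by (rule relpowp_Suc_E)
    note r = Suc.IH[OF z(1)]
    obtain d \<tau> u v where [simp]: "z = (d, \<tau>, u, v)" by (metis surj_pair)
    have "fits K d" using residuals_fits[OF assms(1) r] by simp
    then have "fst y \<in> residuals d"
      using z(2) cdelta_residuals by (fastforce simp: cstep_iff)
    then show ?case using residuals_trans[OF r] by auto
  qed (use residuals_refl[OF assms(1)] in auto)
  have "(\<exists>\<tau> u v. (ostep True A)\<^sup>*\<^sup>* (c, input x) (Chk 1 [], \<tau>, u, v)) \<longleftrightarrow>
    (\<exists>\<tau> u v. (\<tau>, u, v) \<in> Z \<and> u \<in> A)"
  proof
    assume "\<exists>\<tau> u v. (ostep True A)\<^sup>*\<^sup>* (c, input x) (Chk 1 [], \<tau>, u, v)"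
    then obtain k \<tau> u v where k: "(ostep True A ^^ k) (c, input x) (Chk 1 [], \<tau>, u, v)"
      by (meson rtranclp_power)
    have "\<not> (cstep ^^ k) (c, input x) (Chk 1 [], \<tau>, u, v)"
      using cstep_res[of k "(Chk 1 [], \<tau>, u, v)"] assms(4) by auto
    with osteps_decompose[OF k] obtain j \<tau>' u' v' where
      "(cstep ^^ j) (c, input x) (Skip, \<tau>', u', v')"
      "(Chk 1 [], \<tau>, u, v) = (if u' \<in> A then Chk 1 [] else Chk 0 [], \<tau>', [], v')"
      by blast
    moreover from this(2) have "u' \<in> A" by (simp split: if_splits)
    ultimately obtain j \<tau> u v where "(cstep ^^ j) (c, input x) (Skip, \<tau>, u, v)" "u \<in> A"
      by blast
    moreover from this(1) have "(\<tau>, u, v) \<in> Z"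
      unfolding exec_final[OF c, symmetric] by (rule relpowp_imp_rtranclp)
    ultimately show "\<exists>\<tau> u v. (\<tau>, u, v) \<in> Z \<and> u \<in> A" by blast
  next
    assume "\<exists>\<tau> u v. (\<tau>, u, v) \<in> Z \<and> u \<in> A"
    then obtain \<tau> u v where *: "(\<tau>, u, v) \<in> Z" "u \<in> A" by blast
    then have "cstep\<^sup>*\<^sup>* (c, input x) (Skip, \<tau>, u, v)" using exec_final[OF c] by blast
    then have "(ostep True A)\<^sup>*\<^sup>* (c, input x) (Skip, \<tau>, u, v)"
      by (rule rtranclp_mono[THEN predicate2D, rotated]) (auto simp: ostep_def)
    moreover have "ostep True A (Skip, \<tau>, u, v) (Chk 1 [], \<tau>, [], v)"
      using *(2) by (simp add: ostep_def)
    ultimately show "\<exists>\<tau> u v. (ostep True A)\<^sup>*\<^sup>* (c, input x) (Chk 1 [], \<tau>, u, v)"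
      by (blast intro: rtranclp.rtrancl_into_rtrancl)
  qed
  then show ?thesis unfolding compile_reachable[OF assms(1,2)] by auto
qed

end

section \<open>Tape programs\<close>

text \<open>The word \<open>x\<close> seen with the head at position \<open>i\<close>. The position
  is an integer and may lie before or behind the word, which lets heads run past an end without case
  distinctions.\<close>

definition tape_at :: "word \<Rightarrow> int \<Rightarrow> tape" where
  "tape_at x i = (\<lambda>k. word_tape x (k + i))"

lemma tape_at_0: "tape_at x 0 = word_tape x"
  by (simp add: tape_at_def)

lemma tape_at_head: "tape_at x i 0 = word_tape x i"
  by (simp add: tape_at_def)

lemma write_move_tape_at:
  "write_move (word_tape x i, d) (tape_at x i) = tape_at x (i + shift d)"
  by (simp add: write_move_same tape_at_def fun_eq_iff algebra_simps)

lemma word_tape_snoc: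
  "word_tape (x @ [c]) i = (if i = int (length x) then letter c else word_tape x i)"
  by (auto simp: word_tape_def letter_def nth_append)

lemma write_move_append:
  assumes "i = int (length x)"
  shows "write_move (letter c, Right) (tape_at x i) = tape_at (x @ [c]) (i + 1)"
proof
  fix k
  show "write_move (letter c, Right) (tape_at x i) k = tape_at (x @ [c]) (i + 1) k"
    using assms by (cases "k = -1") (auto simp: write_move.simps tape_at_def word_tape_snoc add_ac)
qed

lemma word_tape_letter:
  "k < length x \<Longrightarrow> word_tape x (int k) = letter (x ! k)"
  by (simp add: word_tape_def letter_def)

lemma letter_eq [simp]: "letter c = letter d \<longleftrightarrow> c = d" "letter c \<noteq> 0"
  by (auto simp: letter_def)

lemma letter_True: "letter True = 2"
  by (simp add: letter_def)

lemma word_tape_nonblank: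
  "word_tape x i \<in> set [1, 2] \<longleftrightarrow> 0 \<le> i \<and> i < int (length x)"
  by (simp add: word_tape_def)

lemma word_tape_blank: "word_tape x i = 0 \<longleftrightarrow> \<not> (0 \<le> i \<and> i < int (length x))"
  by (simp add: word_tape_def)

lemma length_unary [simp]: "length (unary n) = n"
  by (simp add: unary_def)

lemma unary_0 [simp]: "unary 0 = []"
  by (simp add: unary_def)

lemma unary_append: "unary n @ [True] = unary (Suc n)"
  by (simp add: unary_def replicate_append_same)

lemma word_tape_unary: "0 \<le> i \<Longrightarrow> i < int n \<Longrightarrow> word_tape (unary n) i = 2"
  by (simp add: word_tape_def unary_def)

text \<open>Meant for a head on tape \<open>i\<close> just behind the word: it steps onto the last
  letter, runs to the blank before the word and returns to the first letter. All tapes in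
  \<open>ts\<close> make the same moves, so any other head is shifted by the length of the word on
  tape \<open>i\<close>.\<close>

definition rewind :: "nat \<Rightarrow> nat list \<Rightarrow> com" where
  "rewind i ts = Op ts None Left ;; While i [1, 2] (Op ts None Left) ;; Op ts None Right"

text \<open>Several tapes can receive the count at once, because every coefficient of a polynomial
  needs its own loop tape.\<close>

definition scan :: "nat \<Rightarrow> nat list \<Rightarrow> nat list \<Rightarrow> com" where
  "scan i S ts = While i S (Op ts (Some 2) Right ;; Op [i] None Right)"

primrec ones :: "nat \<Rightarrow> nat \<Rightarrow> com" where
  "ones t 0 = Skip"
| "ones t (Suc a) = Op [t] (Some 2) Right ;; ones t a"

text \<open>Horner's scheme in unary: one nested loop, over a tape containing \<open>1\<^sup>n\<close>, per coefficient.\<close>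
primrec horner :: "nat \<Rightarrow> nat \<Rightarrow> nat list \<Rightarrow> com" where
  "horner t l [] = Skip"
| "horner t l (a # as) =
     ones t a ;; While l [1, 2] (horner t (Suc l) as ;; Op [l] None Right) ;; rewind l [l]"

primrec horner_value :: "nat list \<Rightarrow> nat \<Rightarrow> nat" where
  "horner_value [] n = 0"
| "horner_value (a # as) n = a + n * horner_value as n"

text \<open>The sum of the costs in the rules: \<open>2 * a\<close> for \<open>ones\<close>; 4 per
  round for the head move, a sequence step, the test and the discarding of the body;
  \<open>3 * n + 5\<close> for \<open>rewind\<close>; 3 for the failing test and two sequence
  steps.\<close>

primrec horner_time :: "nat list \<Rightarrow> nat \<Rightarrow> nat" where
  "horner_time [] n = 0"
| "horner_time (a # as) n = 2 * a + n * (horner_time as n + 4) + 3 * n + 8"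

lemma horner_value_coeffs: "horner_value (coeffs p) n = poly p n"
proof -
  have "horner_value as n = poly (Poly as) n" for as
    by (induction as) auto
  then show ?thesis by simp
qed

lemma horner_time_mono: "m \<le> n \<Longrightarrow> horner_time as m \<le> horner_time as n"
  by (induction as) (auto intro!: add_mono mult_mono)

lemma poly_bounded_horner_time: "poly_bounded (horner_time as)"
proof -
  have "poly_bounded (\<lambda>n. horner_time as n)"
    by (induction as) (simp_all add: poly_bounded_intros)
  then show ?thesis .
qed

section \<open>Correctness of the tape programs\<close>

context embedding
begin

lemma exec_Op':
  assumes "\<tau>' = (\<lambda>i. if i \<in> set ts
      then write_move (case s of None \<Rightarrow> \<tau> i 0 | Some s \<Rightarrow> s, d) (\<tau> i) else \<tau> i)"
  shows "exec (Op ts s d) (\<tau>, u, v) {(\<tau>', u, v)} 1"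
  unfolding assms by (rule exec_Op)

lemma exec_rewind:
  assumes i: "i \<in> set ts" and \<tau>: "\<And>j. j \<in> set ts \<Longrightarrow> \<tau> j = tape_at (w j) (p j)"
    and n: "p i = int n" "length (w i) = n"
  shows "exec (rewind i ts) (\<tau>, u, v)
    {(\<lambda>j. if j \<in> set ts then tape_at (w j) (p j - int n) else \<tau> j, u, v)} (3 * n + 5)"
proof -
  \<comment> \<open>One left move precedes the loop, hence the offset \<open>- 1\<close>.\<close>
  define S where "S k = (\<lambda>j. if j \<in> set ts then tape_at (w j) (p j - 1 - int k) else \<tau> j)" for k
  have "exec (Op ts None Left) (\<tau>, u, v) {(S 0, u, v)} 1"
    by (rule exec_Op') (auto simp: S_def \<tau> tape_at_head write_move_tape_at fun_eq_iff)
  moreover have "exec (While i [1, 2] (Op ts None Left)) (S 0, u, v) {(S n, u, v)} (n * (1 + 2) + 1)"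
  proof (rule exec_While_iterate)
    show "S k i 0 \<in> set [1, 2]" if "k < n" for k
      unfolding S_def using i n that by (simp only: if_True tape_at_head word_tape_nonblank) simp
    show "S n i 0 \<notin> set [1, 2]"
      unfolding S_def using i n by (simp only: if_True tape_at_head word_tape_nonblank) simp
    show "exec (Op ts None Left) (S k, u, v) {(S (Suc k), u, v)} 1" for k
      by (rule exec_Op') (auto simp: S_def tape_at_head write_move_tape_at fun_eq_iff algebra_simps)
  qed
  moreover have "exec (Op ts None Right) (S n, u, v)
      {(\<lambda>j. if j \<in> set ts then tape_at (w j) (p j - int n) else \<tau> j, u, v)} 1"
    by (rule exec_Op') (auto simp: S_def tape_at_head write_move_tape_at fun_eq_iff)
  ultimately have "exec (rewind i ts) (\<tau>, u, v)
      {(\<lambda>j. if j \<in> set ts then tape_at (w j) (p j - int n) else \<tau> j, u, v)}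
      (1 + (n * (1 + 2) + 1 + 1 + 1) + 1)"
    unfolding rewind_def by (intro exec_Seq_det)
  then show ?thesis by (rule exec_mono) simp
qed

lemma exec_scan:
  assumes i: "i \<notin> set ts" "\<tau> i = tape_at w 0" and ts: "\<And>j. j \<in> set ts \<Longrightarrow> \<tau> j = tape_at [] 0"
    and S: "\<And>k. k < n \<Longrightarrow> word_tape w (int k) \<in> set S" "word_tape w (int n) \<notin> set S"
  shows "exec (scan i S ts) (\<tau>, u, v)
    {(\<lambda>j. if j = i then tape_at w (int n) else if j \<in> set ts then tape_at (unary n) (int n) else \<tau> j, u, v)}
    (5 * n + 1)"
proof -
  define R where "R k = (\<lambda>j. if j = i then tape_at w (int k)
      else if j \<in> set ts then tape_at (unary k) (int k) else \<tau> j)" for k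
  define R' where "R' k = (\<lambda>j. if j = i then tape_at w (int k)
      else if j \<in> set ts then tape_at (unary (Suc k)) (int (Suc k)) else \<tau> j)" for k
  have "exec (scan i S ts) (R 0, u, v) {(R n, u, v)} (n * (3 + 2) + 1)"
    unfolding scan_def
  proof (rule exec_While_iterate)
    show "R k i 0 \<in> set S" if "k < n" for k
      using S(1)[OF that] by (simp add: R_def tape_at_head)
    show "R n i 0 \<notin> set S"
      using S(2) by (simp add: R_def tape_at_head)
    fix k
    have "write_move (2, Right) (tape_at (unary k) (int k)) = tape_at (unary (Suc k)) (1 + int k)"
      using write_move_append[of "int k" "unary k" True]
      by (simp add: letter_True unary_append add.commute)
    then have "exec (Op ts (Some 2) Right) (R k, u, v) {(R' k, u, v)} 1"
      by (intro exec_Op') (use i in \<open>auto simp: R_def R'_def fun_eq_iff\<close>)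
    moreover have "exec (Op [i] None Right) (R' k, u, v) {(R (Suc k), u, v)} 1"
      by (rule exec_Op') (use i in \<open>auto simp: R_def R'_def fun_eq_iff tape_at_head write_move_tape_at algebra_simps\<close>)
    ultimately show "exec (Op ts (Some 2) Right ;; Op [i] None Right) (R k, u, v) {(R (Suc k), u, v)} 3"
      by (rule exec_mono[OF exec_Seq_det]) simp
  qed
  moreover have "R 0 = \<tau>" using i ts by (auto simp: R_def fun_eq_iff)
  ultimately show ?thesis
    by (simp add: R_def mult.commute)
qed

lemma exec_ones:
  assumes "\<tau> t = tape_at (unary m) (int m)"
  shows "exec (ones t a) (\<tau>, u, v) {(\<tau>(t := tape_at (unary (m + a)) (int (m + a))), u, v)} (2 * a)"
  using assms
proof (induction a arbitrary: \<tau> m)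
  case 0
  then have "\<tau>(t := tape_at (unary m) (int m)) = \<tau>" by auto
  then show ?case using exec_Skip by simp
next
  case (Suc a)
  let ?\<tau> = "\<tau>(t := tape_at (unary (Suc m)) (int (Suc m)))"
  have "write_move (2, Right) (tape_at (unary m) (int m)) = tape_at (unary (Suc m)) (1 + int m)"
    using write_move_append[of "int m" "unary m" True]
    by (simp add: letter_True unary_append add.commute)
  then have "exec (Op [t] (Some 2) Right) (\<tau>, u, v) {(?\<tau>, u, v)} 1"
    by (intro exec_Op' ext) (simp add: Suc.prems)
  moreover have "exec (ones t a) (?\<tau>, u, v)
      {(?\<tau>(t := tape_at (unary (Suc m + a)) (int (Suc m + a))), u, v)} (2 * a)"
    by (rule Suc.IH) simp
  ultimately have "exec (ones t (Suc a)) (\<tau>, u, v)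
      {(?\<tau>(t := tape_at (unary (Suc m + a)) (int (Suc m + a))), u, v)} (1 + 2 * a + 1)"
    unfolding ones.simps by (rule exec_Seq_det)
  then show ?case
    unfolding fun_upd_upd add_Suc_shift by (rule exec_mono) simp
qed

text \<open>Tape \<open>t\<close> is an accumulator, and \<open>m\<close> is arbitrary because
  inside the loops a value is appended to earlier ones. Every loop tape is rewound at the end, so
  the inner evaluation can be repeated in each of the \<open>n\<close> rounds.\<close>

lemma exec_horner:
  assumes "t < l \<or> l + length as \<le> t" and "\<And>i. i < length as \<Longrightarrow> \<tau> (l + i) = tape_at (unary n) 0"
    and "\<tau> t = tape_at (unary m) (int m)"
  shows "exec (horner t l as) (\<tau>, u, v)
    {(\<tau>(t := tape_at (unary (m + horner_value as n)) (int (m + horner_value as n))), u, v)}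
    (horner_time as n)"
  using assms
proof (induction as arbitrary: \<tau> l m)
  case Nil
  then have "\<tau>(t := tape_at (unary m) (int m)) = \<tau>" by auto
  then show ?case using exec_Skip by simp
next
  case (Cons a as)
  let ?H = "horner_value as n"
  have l: "l \<noteq> t" "\<tau> l = tape_at (unary n) 0" using Cons.prems(1) Cons.prems(2)[of 0] by auto
  \<comment> \<open>After \<open>k\<close> rounds the value of the remaining coefficients has been
    appended \<open>k\<close> times.\<close>
  define S where "S k = \<tau>(t := tape_at (unary (m + a + k * ?H)) (int (m + a + k * ?H)),
    l := tape_at (unary n) (int k))" for k
  have "exec (ones t a) (\<tau>, u, v) {(\<tau>(t := tape_at (unary (m + a)) (int (m + a))), u, v)} (2 * a)"
    using Cons.prems(3) by (rule exec_ones)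
  moreover have "\<tau>(t := tape_at (unary (m + a)) (int (m + a))) = S 0"
    using l by (auto simp: S_def)
  ultimately have 1: "exec (ones t a) (\<tau>, u, v) {(S 0, u, v)} (2 * a)" by simp
  have 2: "exec (While l [1, 2] (horner t (Suc l) as ;; Op [l] None Right)) (S 0, u, v) {(S n, u, v)}
    (n * ((horner_time as n + 2) + 2) + 1)"
  proof (rule exec_While_iterate)
    show "S k l 0 \<in> set [1, 2]" if "k < n" for k
      using that l unfolding S_def by (simp only: fun_upd_same tape_at_head word_tape_nonblank) simp
    show "S n l 0 \<notin> set [1, 2]"
      using l unfolding S_def by (simp only: fun_upd_same tape_at_head word_tape_nonblank) simp
    fix k
    let ?S = "(S k)(t := tape_at (unary (m + a + k * ?H + ?H)) (int (m + a + k * ?H + ?H)))"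
    have "exec (horner t (Suc l) as) (S k, u, v) {(?S, u, v)} (horner_time as n)"
    proof (rule Cons.IH)
      show "t < Suc l \<or> Suc l + length as \<le> t" using Cons.prems(1) by auto
      show "S k (Suc l + i) = tape_at (unary n) 0" if "i < length as" for i
        using Cons.prems(1) Cons.prems(2)[of "Suc i"] that by (auto simp: S_def)
      show "S k t = tape_at (unary (m + a + k * ?H)) (int (m + a + k * ?H))"
        using l by (simp add: S_def)
    qed
    moreover have "exec (Op [l] None Right) (?S, u, v) {(S (Suc k), u, v)} 1"
      by (rule exec_Op') (use l in \<open>auto simp: S_def fun_eq_iff tape_at_head write_move_tape_at algebra_simps\<close>)
    ultimately have "exec (horner t (Suc l) as ;; Op [l] None Right) (S k, u, v) {(S (Suc k), u, v)}
        (horner_time as n + 1 + 1)"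
      by (rule exec_Seq_det)
    then show "exec (horner t (Suc l) as ;; Op [l] None Right) (S k, u, v) {(S (Suc k), u, v)}
        (horner_time as n + 2)"
      by simp
  qed
  have "exec (rewind l [l]) (S n, u, v)
      {(\<lambda>j. if j \<in> set [l] then tape_at (unary n) (int n - int n) else S n j, u, v)} (3 * n + 5)"
    by (rule exec_rewind) (auto simp: S_def)
  moreover have "(\<lambda>j. if j \<in> set [l] then tape_at (unary n) (int n - int n) else S n j) =
      \<tau>(t := tape_at (unary (m + horner_value (a # as) n)) (int (m + horner_value (a # as) n)))"
    using l by (auto simp: S_def fun_eq_iff add.assoc)
  ultimately have 3: "exec (rewind l [l]) (S n, u, v)
      {(\<tau>(t := tape_at (unary (m + horner_value (a # as) n)) (int (m + horner_value (a # as) n))), u, v)}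
      (3 * n + 5)"
    by simp
  show ?case
    unfolding horner.simps
    by (rule exec_mono[OF exec_Seq_det[OF 1 exec_Seq_det[OF 2 3]]]) (simp add: algebra_simps)
qed

lemma exec_copy:
  assumes "0 < t" and "\<tau> 0 = tape_at w (int m)" "m \<le> length w" "\<tau> t = tape_at [] 0"
  shows "exec (While 0 [1, 2] (Cpy 0 t)) (\<tau>, u, v)
    {(\<tau>(0 := tape_at w (int (length w)), t := tape_at (drop m w) (int (length w - m))), u, v)}
    (3 * length w + 1)"
proof -
  let ?x = "drop m w" and ?n = "length w - m"
  define S where "S k = \<tau>(0 := tape_at w (int m + int k), t := tape_at (take k ?x) (int k))" for k
  have "exec (While 0 [1, 2] (Cpy 0 t)) (S 0, u, v) {(S ?n, u, v)} (?n * (1 + 2) + 1)"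
  proof (rule exec_While_iterate)
    show "S k 0 0 \<in> set [1, 2]" if "k < ?n" for k
      using that assms(1) unfolding S_def by (simp only: fun_upd_same fun_upd_other tape_at_head word_tape_nonblank) simp
    show "S ?n 0 0 \<notin> set [1, 2]"
      using assms(1,3) unfolding S_def by (simp only: fun_upd_same fun_upd_other tape_at_head word_tape_nonblank) simp
    fix k assume k: "k < ?n"
    have head: "word_tape w (int m + int k) = letter (?x ! k)"
      using k word_tape_letter[of "m + k" w] by simp
    have "write_move (letter (?x ! k), Right) (tape_at (take k ?x) (int k)) = tape_at (take k ?x @ [?x ! k]) (int k + 1)"
      by (rule write_move_append) (use k in simp)
    also have "take k ?x @ [?x ! k] = take (Suc k) ?x"
      using k by (simp add: take_Suc_conv_app_nth)
    finally have "(S k)(0 := write_move (S k 0 0, Right) (S k 0), t := write_move (S k 0 0, Right) (S k t)) =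
        S (Suc k)"
      using assms(1) write_move_tape_at[of w "int m + int k" Right] head
      by (auto simp: S_def tape_at_head fun_eq_iff add.commute add.left_commute)
    then show "exec (Cpy 0 t) (S k, u, v) {(S (Suc k), u, v)} 1"
      using exec_Cpy[of 0 t "S k" u v] by simp
  qed
  moreover have "S 0 = \<tau>" using assms by (auto simp: S_def fun_eq_iff)
  moreover have "S ?n = \<tau>(0 := tape_at w (int (length w)), t := tape_at ?x (int ?n))"
    using assms(3) by (auto simp: S_def fun_eq_iff of_nat_diff)
  ultimately have "exec (While 0 [1, 2] (Cpy 0 t)) (\<tau>, u, v)
      {(\<tau>(0 := tape_at w (int (length w)), t := tape_at ?x (int ?n)), u, v)} (?n * (1 + 2) + 1)"
    by simp
  then show ?thesis by (rule exec_mono) simp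
qed

end

section \<open>Machines for the reductions\<close>

lemma word_cases:
  obtains (unary) n where "w = unary n" | (split) n u where "w = unary n @ False # u"
proof -
  have "(\<exists>n. w = unary n) \<or> (\<exists>n u. w = unary n @ False # u)"
  proof (induction w)
    case Nil
    have "[] = unary 0" by simp
    then show ?case by blast
  next
    case (Cons c w)
    show ?case
    proof (cases c)
      case c: True
      from Cons show ?thesis
      proof (elim disjE exE)
        fix n assume "w = unary n"
        then have "c # w = unary (Suc n)" using c by (simp add: unary_def)
        then show ?thesis by blast
      next
        fix n u assume "w = unary n @ False # u"
        then have "c # w = unary (Suc n) @ False # u" using c by (simp add: unary_def)
        then show ?thesis by blast
      qed
    next
      case False
      then have "c # w = unary 0 @ False # w" by simp
      then show ?thesis by blast
    qed
  qed
  then show thesis using that by blast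
qed

lemma takeWhile_unary:
  "takeWhile id (unary n) = unary n" "takeWhile id (unary n @ False # u) = unary n"
  by (induction n) (auto simp: unary_def)

lemma unary_inject [simp]: "unary m = unary n \<longleftrightarrow> m = n"
  by (metis length_unary)

lemma unary_split_neq: "unary m \<noteq> unary n @ False # u"
  by (metis append_self_conv list.distinct(1) takeWhile_unary)

lemma unary_split_inject [simp]:
  "unary m @ False # u = unary n @ False # v \<longleftrightarrow> m = n \<and> u = v"
  by (metis list.inject same_append_eq takeWhile_unary(2) unary_inject)

lemma word_tape_unary_end: "word_tape (unary n) (int n) = 0"
  by (simp add: word_tape_def)

lemma word_tape_split:
  assumes "w = unary n @ False # u"
  shows "k < n \<Longrightarrow> word_tape w (int k) = 2" "word_tape w (int n) = 1"
  using assms by (auto simp: word_tape_def nth_append unary_def)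

lemma tape_at_split:
  "0 \<le> k \<Longrightarrow> tape_at (unary n @ False # u) (int n + 1) k = word_tape u k"
  by (auto simp: tape_at_def word_tape_def nth_append nat_add_distrib)

text \<open>
  Splits \<open>1\<^sup>n 0 u\<close> and checks that \<open>|u| + 1\<close> is the value at \<open>n\<close> of the polynomial with
  coefficients \<open>as\<close>.  Tape 1 receives this value in unary; it is rewound together with \<open>u\<close>, so that
  the lengths agree iff its head ends up on the first letter.
\<close>
definition parse :: "nat \<Rightarrow> nat \<Rightarrow> nat list \<Rightarrow> com" where
  "parse b t as =
     scan 0 [2] (b # [3..<3 + length as]) ;; Chk 0 [1] ;; Op [0] None Right ;;
     While 0 [1, 2] (Cpy 0 t) ;; rewind b (b # [3..<3 + length as]) ;; horner 1 3 as ;;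
     rewind t [t, 1] ;; Op [1] None Left ;; Chk 1 [2] ;; Op [1] None Left ;; Chk 1 [0]"

text \<open>Both \<open>n\<close> and the length of \<open>u\<close> are at most \<open>m\<close>;
  the factor 14 is 5 for the scan plus 3 for the copy and for each of the two rewinds outside
  \<open>horner\<close>, and 40 covers the constants.\<close>

definition parse_time :: "nat list \<Rightarrow> nat \<Rightarrow> nat" where
  "parse_time as m = horner_time as m + 14 * m + 40"

context embedding
begin

lemma exec_Seq_Chk_fail:
  assumes "\<tau> i 0 \<notin> set S"
  shows "exec (Chk i S ;; d) (\<tau>, u, v) {} 2"
  using exec_Seq[OF exec_Chk[of i S \<tau> u v], of d "\<lambda>_. {}" 0] assms by (simp add: numeral_2_eq_2)

text \<open>Tape layout: 0 holds the input, 1 the value of the polynomial, 3 to \<open>b - 1\<close>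
  the loop tapes, \<open>b\<close> a further copy of 1^n and \<open>t\<close> the remaining word.
  Tape \<open>b\<close> is the first tape of \<open>M\<close>, so that its input is in place;
  \<open>t = 2\<close> keeps the rest outside \<open>M\<close>, and \<open>t = b + 1\<close> makes
  it a second input.\<close>

lemma exec_parse:
  assumes w: "w = unary n @ False # u" and b: "b = 3 + length as" and t: "t = 2 \<or> b < t"
  shows "\<exists>\<tau>. exec (parse b t as) (input w)
      (if horner_value as n = Suc (length u) then {(\<tau>, [], [])} else {}) (parse_time as (length w)) \<and>
    \<tau> b = word_tape (unary n) \<and> \<tau> t = word_tape u \<and>
    (\<forall>i. b < i \<longrightarrow> i \<noteq> t \<longrightarrow> \<tau> i = word_tape [])"
proof -
  let ?N = "b # [3..<3 + length as]" and ?R = "horner_value as n" and ?u = "int (length u)"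
  have N: "j \<in> set ?N \<longleftrightarrow> 3 \<le> j \<and> j \<le> b" for j using b by auto
  define \<tau>0 where "\<tau>0 = (\<lambda>i::nat. if i = 0 then word_tape w else word_tape [])"
  define \<tau>1 where "\<tau>1 = (\<lambda>j. if j = 0 then tape_at w (int n)
      else if j \<in> set ?N then tape_at (unary n) (int n) else \<tau>0 j)"
  define \<tau>2 where "\<tau>2 = \<tau>1(0 := tape_at w (int (Suc n)))"
  define \<tau>3 where "\<tau>3 = \<tau>2(0 := tape_at w (int (length w)), t := tape_at u (int (length w - Suc n)))"
  define \<tau>4 where "\<tau>4 = (\<lambda>j. if j \<in> set ?N then tape_at (unary n) (int n - int n) else \<tau>3 j)"
  define \<tau>5 where "\<tau>5 = \<tau>4(1 := tape_at (unary (0 + ?R)) (int (0 + ?R)))"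
  define x where "x j = (if j = t then u else unary ?R)" for j
  define p where "p j = (if j = t then ?u else int ?R)" for j
  define \<tau>6 where "\<tau>6 = (\<lambda>j. if j \<in> set [t, 1] then tape_at (x j) (p j - ?u) else \<tau>5 j)"
  define \<tau>7 where "\<tau>7 = \<tau>6(1 := tape_at (unary ?R) (int ?R - ?u - 1))"
  define \<tau>8 where "\<tau>8 = \<tau>7(1 := tape_at (unary ?R) (int ?R - ?u - 2))"
  have t1: "t \<noteq> 0" "t \<noteq> 1" "t \<notin> set ?N" "t \<noteq> b" "\<not> (3 \<le> t \<and> t < 3 + length as)"
    using t b by auto
  have lw: "length w = n + 1 + length u" using w by simp
  have 1: "exec (scan 0 [2] ?N) (\<tau>0, [], []) {(\<tau>1, [], [])} (5 * n + 1)"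
    unfolding \<tau>1_def
    by (rule exec_scan) (use N b in \<open>auto simp: \<tau>0_def tape_at_0 word_tape_split[OF w]\<close>)
  have 2: "exec (Op [0] None Right) (\<tau>1, [], []) {(\<tau>2, [], [])} 1"
    by (rule exec_Op'; rule ext) (auto simp: \<tau>2_def \<tau>1_def tape_at_head write_move_tape_at add.commute)
  have 3: "exec (While 0 [1, 2] (Cpy 0 t)) (\<tau>2, [], []) {(\<tau>3, [], [])} (3 * length w + 1)"
  proof -
    have "drop (Suc n) w = u" using w by simp
    moreover have "exec (While 0 [1, 2] (Cpy 0 t)) (\<tau>2, [], [])
      {(\<tau>2(0 := tape_at w (int (length w)), t := tape_at (drop (Suc n) w) (int (length w - Suc n))), [], [])}
      (3 * length w + 1)"
      by (rule exec_copy) (use t1 lw N in \<open>auto simp: \<tau>2_def \<tau>1_def \<tau>0_def tape_at_0\<close>)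
    ultimately show ?thesis by (simp add: \<tau>3_def)
  qed
  have 4: "exec (rewind b ?N) (\<tau>3, [], []) {(\<tau>4, [], [])} (3 * n + 5)"
    unfolding \<tau>4_def
    by (rule exec_rewind[where w = "\<lambda>_. unary n" and p = "\<lambda>_. int n"])
      (use t1 N b in \<open>auto simp: \<tau>3_def \<tau>2_def \<tau>1_def\<close>)
  have 5: "exec (horner 1 3 as) (\<tau>4, [], []) {(\<tau>5, [], [])} (horner_time as n)"
    unfolding \<tau>5_def
    by (rule exec_horner)
      (use t1 N b in \<open>auto simp: \<tau>4_def \<tau>3_def \<tau>2_def \<tau>1_def \<tau>0_def tape_at_0\<close>)
  have \<tau>5: "\<tau>5 t = tape_at u ?u" "\<tau>5 1 = tape_at (unary ?R) (int ?R)"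
    using t1 lw by (auto simp: \<tau>5_def \<tau>4_def \<tau>3_def)
  have 6: "exec (rewind t [t, 1]) (\<tau>5, [], []) {(\<tau>6, [], [])} (3 * length u + 5)"
    unfolding \<tau>6_def
  proof (rule exec_rewind)
    show "\<tau>5 j = tape_at (x j) (p j)" if "j \<in> set [t, 1]" for j
      using that t1 \<tau>5 by (auto simp: x_def p_def simp del: One_nat_def)
  qed (simp_all add: x_def p_def)
  have 7: "exec (Op [1] None Left) (\<tau>6, [], []) {(\<tau>7, [], [])} 1"
    by (rule exec_Op'; rule ext)
      (use t1 in \<open>auto simp: \<tau>7_def \<tau>6_def x_def p_def tape_at_head write_move_tape_at\<close>)
  have 8: "exec (Op [1] None Left) (\<tau>7, [], []) {(\<tau>8, [], [])} 1"
    by (rule exec_Op'; rule ext) (auto simp: \<tau>8_def \<tau>7_def tape_at_head write_move_tape_at)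
  note 9 = exec_Seq_Chk[OF exec_Seq_det[OF 8 exec_Chk[of 1 "[0]" \<tau>8]], of 1 "[2]"]
  \<comment> \<open>With R the value and l the length of \<open>u\<close>, the head of tape 1 stood
    at R - l after the rewind. A nonblank cell R - l - 1 means R > l, and a blank cell R - l - 2
    means R \<le> l + 1.\<close>
  have eq: "(if \<tau>7 1 0 \<in> set [2] then if \<tau>8 1 0 \<in> set [0] then {(\<tau>8, [], [])} else {} else {}) =
      (if ?R = Suc (length u) then {(\<tau>8, [], [])} else {})"
  proof -
    have 7: "\<tau>7 1 0 = 2 \<longleftrightarrow> int ?R - ?u - 1 \<ge> 0"
      unfolding \<tau>7_def fun_upd_same tape_at_head
      by (auto simp: word_tape_unary) (auto simp: word_tape_def split: if_splits)
    have 8: "\<tau>8 1 0 = 0 \<longleftrightarrow> int ?R - ?u - 2 < 0"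
      unfolding \<tau>8_def fun_upd_same tape_at_head word_tape_blank by auto
    show ?thesis using 7 8 by auto
  qed
  have 9: "exec (Chk 1 [2] ;; Op [1] None Left ;; Chk 1 [0]) (\<tau>7, [], [])
      (if ?R = Suc (length u) then {(\<tau>8, [], [])} else {}) 5"
    using 9 unfolding eq by (rule exec_mono) simp
  note 10 = exec_Seq_det[OF 2 exec_Seq_det[OF 3 exec_Seq_det[OF 4 exec_Seq_det[OF 5
      exec_Seq_det[OF 6 exec_Seq_det[OF 7 9]]]]]]
  have head: "\<tau>1 0 0 \<in> set [1]"
    using word_tape_split(2)[OF w] by (simp add: \<tau>1_def tape_at_head)
  have "exec (parse b t as) (\<tau>0, [], [])
      (if ?R = Suc (length u) then {(\<tau>8, [], [])} else {}) (parse_time as (length w))"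
    unfolding parse_def
    using exec_Seq_det[OF 1 exec_Seq_Chk[OF 10, of 0 "[1]"], unfolded if_P[OF head]]
  proof (rule exec_mono)
    have "horner_time as n \<le> horner_time as (length w)"
      by (rule horner_time_mono) (use lw in simp)
    then show "5 * n + 1 + (1 + (3 * length w + 1 + (3 * n + 5 + (horner_time as n +
        (3 * length u + 5 + (1 + 5 + 1) + 1) + 1) + 1) + 1) + 1 + 2) + 1 \<le> parse_time as (length w)"
      using lw unfolding parse_time_def by linarith
  qed
  moreover have "\<tau>8 b = word_tape (unary n)"
    using t1 b by (simp add: \<tau>8_def \<tau>7_def \<tau>6_def \<tau>5_def \<tau>4_def tape_at_0)
  moreover have "\<tau>8 t = word_tape u"
    using t1 by (simp add: \<tau>8_def \<tau>7_def \<tau>6_def x_def p_def tape_at_0)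
  moreover have "\<tau>8 i = word_tape []" if "b < i" "i \<noteq> t" for i
    using that N b by (simp add: \<tau>8_def \<tau>7_def \<tau>6_def \<tau>5_def \<tau>4_def \<tau>3_def \<tau>2_def \<tau>1_def \<tau>0_def)
  ultimately show ?thesis
    unfolding input_def \<tau>0_def by blast
qed

text \<open>Without a letter 0 the scan ends on a blank, where \<open>Chk 0 [1]\<close> blocks; such
  failing runs still need a time bound.\<close>

lemma exec_parse_unary:
  assumes b: "b = 3 + length as"
  shows "exec (parse b t as) (input (unary n)) {} (parse_time as n)"
proof -
  let ?N = "b # [3..<3 + length as]"
  define \<tau>0 where "\<tau>0 = (\<lambda>i::nat. if i = 0 then word_tape (unary n) else word_tape [])"
  define \<tau>1 where "\<tau>1 = (\<lambda>j. if j = 0 then tape_at (unary n) (int n)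
      else if j \<in> set ?N then tape_at (unary n) (int n) else \<tau>0 j)"
  have 1: "exec (scan 0 [2] ?N) (\<tau>0, [], []) {(\<tau>1, [], [])} (5 * n + 1)"
    unfolding \<tau>1_def
    by (rule exec_scan) (use b in \<open>auto simp: \<tau>0_def tape_at_0 word_tape_unary word_tape_unary_end\<close>)
  have "\<tau>1 0 0 \<notin> set [1]"
    by (simp add: \<tau>1_def tape_at_head word_tape_unary_end)
  from exec_Seq_Chk_fail[of \<tau>1, OF this] exec_Seq_det[OF 1]
  show ?thesis
    unfolding parse_def input_def \<tau>0_def[symmetric]
    by (rule_tac exec_mono) (blast, simp add: parse_time_def)
qed

lemma fits_ones: "t < K \<Longrightarrow> fits K (ones t a)"
  by (induction a) auto

lemma fits_horner: "t < K \<Longrightarrow> l + length as \<le> K \<Longrightarrow> fits K (horner t l as)"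
  by (induction as arbitrary: l) (auto simp: fits_ones rewind_def)

lemma guess_free_horner: "guess_free (horner t l as)"
proof -
  have "guess_free (ones t a)" for a by (induction a) auto
  then show ?thesis by (induction as arbitrary: l) (auto simp: rewind_def)
qed

lemma start_M: "start M \<in> states M"
  using wf by (auto simp: well_formed_def)

lemma tapes_M: "1 \<le> tapes M"
  using wf by (auto simp: well_formed_def)

lemma fits_parse:
  "3 + length as \<le> b \<Longrightarrow> t < b + tapes M \<Longrightarrow> fits (b + tapes M) (parse b t as)"
  using tapes_M by (auto simp: parse_def scan_def rewind_def intro!: fits_horner)

end

lemma poly_bounded_parse_time: "poly_bounded (parse_time as)"
proof -
  have "poly_bounded (\<lambda>m. parse_time as m)"
    unfolding parse_time_def by (intro poly_bounded_intros poly_bounded_horner_time)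
  then show ?thesis .
qed

section \<open>Programs for the reductions\<close>

context embedding
begin

lemma exec_Seq_empty:
  assumes "exec c s {} T"
  shows "exec (c ;; d) s {} (T + T' + 1)"
  using exec_Seq[OF assms, of d "\<lambda>_. {}" T'] by simp

lemma exec_Seq_if:
  assumes "exec c s (if P then {r} else {}) T" "exec d r Z T'"
  shows "exec (c ;; d) s (if P then Z else {}) (T + T' + 1)"
  using assms exec_Seq_det[of c s r T d Z T'] exec_Seq_empty[of c s T d T'] by (cases P) simp_all

text \<open>In mode \<open>Query\<close> the output of \<open>M\<close> has become the content of
  the query device, which is what the closing query asks about.\<close>

lemma place_Query:
  assumes "md = Query"
  shows "(\<exists>\<tau>' u v. (\<tau>', u, v) \<in> {place (\<tau>, [], []) ts w | ts w. final xs ts w \<and> matches (\<tau>, [], []) w} \<and> u \<in> A)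
    \<longleftrightarrow> outputs M {} xs \<inter> A \<noteq> {}"
proof -
  have p: "place (\<tau>, [], []) ts w = (fst (place (\<tau>, [], []) ts w), w, [])" for ts w
    unfolding place_def using assms by simp
  have m: "matches (\<tau>, [], []) w" for w unfolding matches_def using assms by simp
  show ?thesis
  proof
    assume "\<exists>\<tau>' u v. (\<tau>', u, v) \<in> {place (\<tau>, [], []) ts w | ts w. final xs ts w \<and> matches (\<tau>, [], []) w} \<and> u \<in> A"
    then obtain \<tau>' u v ts w where *: "(\<tau>', u, v) = place (\<tau>, [], []) ts w" "final xs ts w" "u \<in> A"
      by blast
    from *(1) have "u = w" by (subst (asm) p) simp
    then show "outputs M {} xs \<inter> A \<noteq> {}" using * unfolding outputs_final by blast
  next
    assume "outputs M {} xs \<inter> A \<noteq> {}"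
    then obtain ts w where w: "final xs ts w" "w \<in> A" unfolding outputs_final by blast
    then have "(fst (place (\<tau>, [], []) ts w), w, []) \<in>
        {place (\<tau>, [], []) ts w | ts w. final xs ts w \<and> matches (\<tau>, [], []) w}"
      using m[of w] unfolding p[symmetric] by blast
    with w(2) show "\<exists>\<tau>' u v. (\<tau>', u, v) \<in> {place (\<tau>, [], []) ts w | ts w. final xs ts w \<and> matches (\<tau>, [], []) w} \<and> u \<in> A"
      by blast
  qed
qed

text \<open>\<open>parse\<close> leaves 1^n and \<open>u\<close> on the tapes \<open>b\<close> and
  \<open>b + 1\<close>, exactly where the pairing machine expects its two arguments. Its total input
  is shorter than \<open>w\<close>, so its time is bounded in the length of
  \<open>w\<close>.\<close>

lemma exec_pairing:
  assumes md: "md = Query" and b: "b = 3 + length as" and "2 \<le> tapes M"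
    and time: "\<And>x y k c. (step M {} ^^ k) (init M [x, y]) c \<Longrightarrow> k \<le> poly q (length x + length y)"
  shows "\<exists>Z. exec (parse b (b + 1) as ;; Run (start M)) (input w) Z
      (parse_time as (length w) + Suc (poly q (length w)) + 1) \<and>
    ((\<exists>\<tau> u v. (\<tau>, u, v) \<in> Z \<and> u \<in> A) \<longleftrightarrow>
     (\<exists>n u. w = unary n @ False # u \<and> horner_value as n = Suc (length u) \<and>
        outputs M {} [unary n, u] \<inter> A \<noteq> {}))"
proof (cases w rule: word_cases)
  case (unary n)
  have "exec (parse b (b + 1) as ;; Run (start M)) (input w) {}
      (parse_time as (length w) + Suc (poly q (length w)) + 1)"
    by (rule exec_Seq_empty) (use exec_parse_unary[OF b, of "b + 1" n] unary in simp)
  moreover have "\<not> (\<exists>n u. w = unary n @ False # u)"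
    by (simp add: unary unary_split_neq)
  ultimately show ?thesis by (intro exI[of _ "{}"]) simp
next
  case (split n u)
  obtain \<tau> where
    parse: "exec (parse b (b + 1) as) (input w)
      (if horner_value as n = Suc (length u) then {(\<tau>, [], [])} else {}) (parse_time as (length w))"
    and \<tau>: "\<tau> b = word_tape (unary n)" "\<tau> (b + 1) = word_tape u"
      "\<And>i. b < i \<Longrightarrow> i \<noteq> b + 1 \<Longrightarrow> \<tau> i = word_tape []"
    using exec_parse[OF split b, of "b + 1"] by auto
  let ?Z = "{place (\<tau>, [], []) ts w | ts w. final [unary n, u] ts w \<and> matches (\<tau>, [], []) w}"
  have "exec (Run (start M)) (\<tau>, [], []) ?Z (Suc (poly q (length w)))"
  proof (rule exec_Run)
    show "\<tau> (b + i) = (if i < length [unary n, u] then word_tape ([unary n, u] ! i) else word_tape [])"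
      for i
      using \<tau>(1,2) \<tau>(3)[of "b + i"] by (auto simp: less_Suc_eq nth_Cons split: nat.splits)
    fix k c assume "(step M {} ^^ k) (init M [unary n, u]) c"
    then have "k \<le> poly q (n + length u)" using time[of k "unary n" u c] by simp
    also have "\<dots> \<le> poly q (length w)" by (rule poly_nat_mono) (simp add: split)
    finally show "k \<le> poly q (length w)" .
  qed
  then have "exec (parse b (b + 1) as ;; Run (start M)) (input w)
      (if horner_value as n = Suc (length u) then ?Z else {})
      (parse_time as (length w) + Suc (poly q (length w)) + 1)"
    by (rule exec_Seq_if[OF parse])
  moreover have "(\<exists>n u. w = unary n @ False # u \<and> horner_value as n = Suc (length u) \<and>
        outputs M {} [unary n, u] \<inter> A \<noteq> {}) \<longleftrightarrow>
      horner_value as n = Suc (length u) \<and> outputs M {} [unary n, u] \<inter> A \<noteq> {}"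
    using split by auto
  moreover have "(\<exists>\<tau>' u' v. (\<tau>', u', v) \<in> (if horner_value as n = Suc (length u) then ?Z else {}) \<and> u' \<in> A) \<longleftrightarrow>
      horner_value as n = Suc (length u) \<and> outputs M {} [unary n, u] \<inter> A \<noteq> {}"
    using place_Query[OF md, of \<tau> "[unary n, u]" A] by (cases "horner_value as n = Suc (length u)") (simp_all only: if_True if_False, simp_all)
  ultimately show ?thesis by blast
qed

text \<open>\<open>parse\<close> leaves 1^j 0 v on tape 2; the scan and the move bring the head to
  the beginning of v. \<open>M\<close> then runs on 1^n and its output is compared with v letter by
  letter, so it is never stored. The closing test for a blank excludes that \<open>M\<close> printed
  only a proper prefix of v.\<close>

definition check_output :: "nat list \<Rightarrow> com" where
  "check_output as = parse b 2 as ;; scan 2 [2] [] ;; Chk 2 [1] ;; Op [2] None Right ;;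
     Run (start M) ;; Chk 2 [0]"

lemma exec_check_output:
  assumes md: "md = Compare 2" and b: "b = 3 + length as"
    and time: "\<And>n k c. (step M {} ^^ k) (init M [unary n]) c \<Longrightarrow> k \<le> poly q n"
  shows "\<exists>Z. exec (check_output as) (input w) Z
      (parse_time as (length w) + (5 * length w + poly q (length w) + 20) + 1) \<and>
    (Z \<noteq> {} \<longleftrightarrow>
     (\<exists>n j v. w = unary n @ False # unary j @ False # v \<and>
        horner_value as n = j + length v + 2 \<and> v \<in> outputs M {} [unary n]))"
proof (cases w rule: word_cases)
  case (unary n)
  have "exec (check_output as) (input w) {}
      (parse_time as (length w) + (5 * length w + poly q (length w) + 20) + 1)"
    unfolding check_output_def
    by (rule exec_Seq_empty) (use exec_parse_unary[OF b, of 2 n] unary in simp)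
  moreover have "\<not> (\<exists>n u. w = unary n @ False # u)"
    by (simp add: unary unary_split_neq)
  ultimately show ?thesis by (intro exI[of _ "{}"]) auto
next
  case (split n u)
  obtain \<tau> where
    parse: "exec (parse b 2 as) (input w)
      (if horner_value as n = Suc (length u) then {(\<tau>, [], [])} else {}) (parse_time as (length w))"
    and \<tau>: "\<tau> b = word_tape (unary n)" "\<tau> 2 = word_tape u" "\<And>i. b < i \<Longrightarrow> \<tau> i = word_tape []"
    using exec_parse[OF split b, of 2] b by auto
  let ?rest = "scan 2 [2] [] ;; Chk 2 [1] ;; Op [2] None Right ;; Run (start M) ;; Chk 2 [0]"
  let ?T = "5 * length w + poly q (length w) + 20"
  have "\<exists>Z. exec ?rest (\<tau>, [], []) Z ?T \<and>
    (Z \<noteq> {} \<longleftrightarrow> (\<exists>j v. u = unary j @ False # v \<and> v \<in> outputs M {} [unary n]))"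
  proof (cases u rule: word_cases)
    case (unary j)
    let ?\<tau> = "(\<lambda>i. if i = 2 then tape_at u (int j) else if i \<in> set [] then tape_at (unary j) (int j) else \<tau> i)"
    have "exec (scan 2 [2] []) (\<tau>, [], []) {(?\<tau>, [], [])} (5 * j + 1)"
      by (rule exec_scan) (use \<tau> unary in \<open>auto simp: tape_at_0 word_tape_unary word_tape_unary_end\<close>)
    moreover have "exec (Chk 2 [1] ;; Op [2] None Right ;; Run (start M) ;; Chk 2 [0]) (?\<tau>, [], []) {} 2"
      by (rule exec_Seq_Chk_fail) (simp add: unary tape_at_head word_tape_unary_end)
    ultimately have "exec ?rest (\<tau>, [], []) {} (5 * j + 1 + 2 + 1)" by (rule exec_Seq_det)
    then have "exec ?rest (\<tau>, [], []) {} ?T"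
      by (rule exec_mono) (use unary split in simp)
    moreover have "\<not> (\<exists>j v. u = unary j @ False # v)"
      by (simp add: unary unary_split_neq)
    ultimately show ?thesis by blast
  next
    case v: (split j v)
    define \<tau>1 where "\<tau>1 = (\<lambda>i. if i = 2 then tape_at u (int j) else if i \<in> set [] then tape_at (unary j) (int j) else \<tau> i)"
    define \<tau>2 where "\<tau>2 = \<tau>(2 := tape_at u (int j + 1))"
    let ?Z = "{place (\<tau>2, [], []) ts x | ts x. final [unary n] ts x \<and> matches (\<tau>2, [], []) x}"
    have 1: "exec (scan 2 [2] []) (\<tau>, [], []) {(\<tau>1, [], [])} (5 * j + 1)"
      unfolding \<tau>1_def
      by (rule exec_scan) (use \<tau> in \<open>auto simp: tape_at_0 word_tape_split[OF v]\<close>)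
    have 2: "exec (Op [2] None Right) (\<tau>1, [], []) {(\<tau>2, [], [])} 1"
      by (rule exec_Op'; rule ext) (auto simp: \<tau>1_def \<tau>2_def tape_at_head write_move_tape_at)
    have 3: "exec (Run (start M)) (\<tau>2, [], []) ?Z (Suc (poly q (length w)))"
    proof (rule exec_Run)
      show "\<tau>2 (b + i) = (if i < length [unary n] then word_tape ([unary n] ! i) else word_tape [])" for i
        using \<tau>(1) \<tau>(3)[of "b + i"] b by (auto simp: \<tau>2_def)
      fix k c assume "(step M {} ^^ k) (init M [unary n]) c"
      then have "k \<le> poly q n" by (rule time)
      also have "\<dots> \<le> poly q (length w)" by (rule poly_nat_mono) (simp add: split)
      finally show "k \<le> poly q (length w)" .
    qed
    define keep where "keep r = (if fst r 2 0 \<in> set [0] then {r} else {})" for r :: store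
    have 4: "exec (Chk 2 [0]) r (keep r) 1" for r
      by (cases r) (simp add: keep_def exec_Chk[of 2 "[0]", simplified])
    have head: "\<tau>1 2 0 \<in> set [1]"
      using word_tape_split(2)[OF v] by (simp add: \<tau>1_def tape_at_head)
    have "exec ?rest (\<tau>, [], []) (\<Union>r \<in> ?Z. keep r)
        (5 * j + 1 + ((1 + (Suc (poly q (length w)) + 1 + 1) + 1) + 2) + 1)"
      using exec_Seq_det[OF 1 exec_Seq_Chk[OF exec_Seq_det[OF 2 exec_Seq[OF 3 4]], of 2 "[1]"]]
      unfolding if_P[OF head] .
    then have "exec ?rest (\<tau>, [], []) (\<Union>r \<in> ?Z. keep r) ?T"
      by (rule exec_mono) (use split v in simp)
    moreover have "(\<Union>r \<in> ?Z. keep r) \<noteq> {} \<longleftrightarrow> v \<in> outputs M {} [unary n]"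
    proof -
      have tape: "\<tau>2 2 (int k) = word_tape v (int k)" for k
        unfolding \<tau>2_def v fun_upd_same by (rule tape_at_split) simp
      have matches: "matches (\<tau>2, [], []) x \<longleftrightarrow> (\<forall>k < length x. word_tape v (int k) = letter (x ! k))" for x
        unfolding matches_def by (simp add: md tape)
      have keep: "keep (place (\<tau>2, [], []) ts x) \<noteq> {} \<longleftrightarrow> length v \<le> length x" for ts x
        unfolding keep_def place_def using b tape[of "length x"] by (simp add: md word_tape_blank)
      \<comment> \<open>A match never reads a blank, so \<open>x\<close> is not longer than
        \<open>v\<close>; the closing test gives the other inequality.\<close>
      have "x = v" if m: "matches (\<tau>2, [], []) x" and l: "length v \<le> length x" for x
      proof (rule nth_equalityI)
        have "k < length v" if "k < length x" for k
        proof (rule ccontr)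
          assume "\<not> k < length v"
          then have "word_tape v (int k) = 0" by (simp add: word_tape_blank)
          moreover have "word_tape v (int k) = letter (x ! k)" using m that unfolding matches by blast
          ultimately show False by simp
        qed
        then show len: "length x = length v" using l by (metis le_neq_implies_less less_irrefl)
        show "x ! k = v ! k" if "k < length x" for k
          using m that len word_tape_letter[of k v] unfolding matches by simp
      qed
      moreover have "matches (\<tau>2, [], []) v"
        unfolding matches by (simp add: word_tape_letter)
      ultimately have "(\<exists>ts x. final [unary n] ts x \<and> matches (\<tau>2, [], []) x \<and> length v \<le> length x) \<longleftrightarrow>
          (\<exists>ts. final [unary n] ts v)"
        by blast
      moreover have "(\<Union>r \<in> ?Z. keep r) \<noteq> {} \<longleftrightarrow>
          (\<exists>ts x. final [unary n] ts x \<and> matches (\<tau>2, [], []) x \<and> keep (place (\<tau>2, [], []) ts x) \<noteq> {})"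
        by blast
      ultimately show ?thesis unfolding keep outputs_final by simp
    qed
    moreover have "(\<exists>j v. u = unary j @ False # v \<and> v \<in> outputs M {} [unary n]) \<longleftrightarrow> v \<in> outputs M {} [unary n]"
      using v by simp
    ultimately show ?thesis by blast
  qed
  then obtain Z where Z: "exec ?rest (\<tau>, [], []) Z ?T"
    "Z \<noteq> {} \<longleftrightarrow> (\<exists>j v. u = unary j @ False # v \<and> v \<in> outputs M {} [unary n])"
    by blast
  have "exec (check_output as) (input w)
      (if horner_value as n = Suc (length u) then Z else {}) (parse_time as (length w) + ?T + 1)"
    unfolding check_output_def by (rule exec_Seq_if[OF parse Z(1)])
  moreover have "(if horner_value as n = Suc (length u) then Z else {}) \<noteq> {} \<longleftrightarrow>
      (\<exists>n j v. w = unary n @ False # unary j @ False # v \<and>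
        horner_value as n = j + length v + 2 \<and> v \<in> outputs M {} [unary n])"
    using split Z(2) by auto
  ultimately show ?thesis by blast
qed

text \<open>The value is computed directly on tape \<open>b\<close>, the input tape of
  \<open>M\<close>. The loop tapes lie among 1 to \<open>b - 1\<close>; with
  \<open>b = 2 + length as\<close> this range contains tape 1 even for the zero polynomial, whose
  coefficient list is empty, so \<open>rewind\<close> always has a controlling tape.\<close>

definition evaluate_first :: "nat list \<Rightarrow> com" where
  "evaluate_first as = scan 0 [1, 2] [1..<b] ;; rewind 1 [1..<b] ;; horner b 1 as ;;
     rewind b [b] ;; Run (start M)"

lemma exec_evaluate_first:
  assumes b: "b = 2 + length as" and md: "md = Out"
    and time: "\<And>k c. (step M {} ^^ k) (init M [unary (horner_value as (length x))]) c \<Longrightarrow> k \<le> T"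
  shows "\<exists>Z. exec (evaluate_first as) (input x) Z
      (8 * length x + horner_time as (length x) + 3 * horner_value as (length x) + T + 20) \<and>
    {v. \<exists>\<tau> u. (\<tau>, u, v) \<in> Z} = outputs M {} [unary (horner_value as (length x))]"
proof -
  let ?N = "[1..<b]" and ?n = "length x" and ?H = "horner_value as (length x)"
  have N: "j \<in> set ?N \<longleftrightarrow> 0 < j \<and> j < b" for j by auto
  define \<tau>0 where "\<tau>0 = (\<lambda>i::nat. if i = 0 then word_tape x else word_tape [])"
  define \<tau>1 where "\<tau>1 = (\<lambda>j. if j = 0 then tape_at x (int ?n)
      else if j \<in> set ?N then tape_at (unary ?n) (int ?n) else \<tau>0 j)"
  define \<tau>2 where "\<tau>2 = (\<lambda>j. if j \<in> set ?N then tape_at (unary ?n) (int ?n - int ?n) else \<tau>1 j)"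
  define \<tau>3 where "\<tau>3 = \<tau>2(b := tape_at (unary (0 + ?H)) (int (0 + ?H)))"
  define \<tau>4 where "\<tau>4 = (\<lambda>j. if j \<in> set [b] then tape_at (unary ?H) (int ?H - int ?H) else \<tau>3 j)"
  have 1: "exec (scan 0 [1, 2] ?N) (\<tau>0, [], []) {(\<tau>1, [], [])} (5 * ?n + 1)"
    unfolding \<tau>1_def
  proof (rule exec_scan)
    show "word_tape x (int k) \<in> set [1, 2]" if "k < ?n" for k
      unfolding word_tape_nonblank using that by simp
    show "word_tape x (int ?n) \<notin> set [1, 2]"
      unfolding word_tape_nonblank by simp
  qed (auto simp: \<tau>0_def tape_at_0)
  have "1 \<in> set ?N" unfolding N using b by simp
  then have 2: "exec (rewind 1 ?N) (\<tau>1, [], []) {(\<tau>2, [], [])} (3 * ?n + 5)"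
    unfolding \<tau>2_def
    by (rule exec_rewind[where w = "\<lambda>_. unary ?n" and p = "\<lambda>_. int ?n"]) (auto simp: \<tau>1_def)
  have 3: "exec (horner b 1 as) (\<tau>2, [], []) {(\<tau>3, [], [])} (horner_time as ?n)"
    unfolding \<tau>3_def
    by (rule exec_horner) (use b in \<open>auto simp: \<tau>2_def \<tau>1_def \<tau>0_def tape_at_0\<close>)
  have 4: "exec (rewind b [b]) (\<tau>3, [], []) {(\<tau>4, [], [])} (3 * ?H + 5)"
    unfolding \<tau>4_def
    by (rule exec_rewind[where w = "\<lambda>_. unary ?H" and p = "\<lambda>_. int ?H"]) (auto simp: \<tau>3_def)
  let ?Z = "{place (\<tau>4, [], []) ts v | ts v. final [unary ?H] ts v \<and> matches (\<tau>4, [], []) v}"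
  have 5: "exec (Run (start M)) (\<tau>4, [], []) ?Z (Suc T)"
  proof (rule exec_Run)
    show "\<tau>4 (b + i) = (if i < length [unary ?H] then word_tape ([unary ?H] ! i) else word_tape [])" for i
      using b by (auto simp: \<tau>4_def \<tau>3_def \<tau>2_def \<tau>1_def \<tau>0_def tape_at_0)
  qed (rule time)
  have "exec (evaluate_first as) (input x) ?Z
      (8 * ?n + horner_time as ?n + 3 * ?H + T + 20)"
    unfolding evaluate_first_def input_def \<tau>0_def[symmetric]
    by (rule exec_mono[OF exec_Seq_det[OF 1 exec_Seq_det[OF 2 exec_Seq_det[OF 3 exec_Seq_det[OF 4 5]]]]])
      simp
  moreover have "{v. \<exists>\<tau> u. (\<tau>, u, v) \<in> ?Z} = outputs M {} [unary ?H]"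
    unfolding outputs_final place_def matches_def by (auto simp: md)
  ultimately show ?thesis by blast
qed

definition guess_first :: com where
  "guess_first = While 0 [1, 2] (Guess 1 ;; Op [0] None Right) ;; rewind 1 [1] ;; Run (start M)"

text \<open>\<open>exec_While_iterate\<close> covers deterministic loops only. Here the word guessed
  so far determines the store \<open>G y\<close>, and the induction runs over the number
  \<open>k\<close> of letters still to be guessed.\<close>

lemma exec_guess:
  fixes n :: nat
  defines "G \<equiv> \<lambda>y. ((\<lambda>i::nat. if i = 0 then tape_at (unary n) (int (length y))
      else if i = 1 then tape_at y (int (length y)) else word_tape []), [], y)"
  assumes "length y + k = n"
  shows "exec (While 0 [1, 2] (Guess 1 ;; Op [0] None Right)) (G y)
    {G (y @ z) | z. length z = k} (5 * k + 1)"
  using assms(2)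
proof (induction k arbitrary: y)
  case 0
  obtain \<tau> where G: "G y = (\<tau>, [], y)" "\<tau> 0 = tape_at (unary n) (int n)"
    using 0 by (simp add: G_def)
  have "\<tau> 0 0 \<notin> set [1, 2]" unfolding G(2) tape_at_head word_tape_nonblank by simp
  then have "exec (While 0 [1, 2] (Guess 1 ;; Op [0] None Right)) (G y) {G y} 1"
    unfolding G(1) by (rule exec_While_stop)
  then show ?case by simp
next
  case (Suc k)
  let ?loop = "While 0 [1, 2] (Guess 1 ;; Op [0] None Right)"
  obtain \<tau> where G: "G y = (\<tau>, [], y)" by (simp add: G_def)
  then have \<tau>: "\<tau> = (\<lambda>i::nat. if i = 0 then tape_at (unary n) (int (length y))
      else if i = 1 then tape_at y (int (length y)) else word_tape [])"
    by (simp add: G_def)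
  have op: "exec (Op [0] None Right) (\<tau>(1 := write_move (letter c, Right) (\<tau> 1)), [], y @ [c]) {G (y @ [c])} 1"
    for c
    unfolding G_def
    by (rule exec_Op'; rule ext) (auto simp: \<tau> tape_at_head write_move_tape_at write_move_append add.commute)
  have step: "exec (Guess 1 ;; Op [0] None Right) (G y) (\<Union>c. {G (y @ [c])}) 3"
  proof -
    have "exec (Op [0] None Right) r {G (snd (snd r))} 1"
      if "r \<in> range (\<lambda>c. (\<tau>(1 := write_move (letter c, Right) (\<tau> 1)), [], y @ [c]))" for r
      using that op by auto
    from exec_Seq[OF exec_Guess[of 1 \<tau> "[]" y] this]
    show ?thesis unfolding G by (simp add: image_image numeral_3_eq_3)
  qed
  \<comment> \<open>\<open>exec_Seq\<close> wants the second set of stores as a function of the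
    intermediate store; the guessed word is recovered from that store as the printed word.\<close>
  have "exec ?loop r {G (snd (snd r) @ z) | z. length z = k} (5 * k + 1)"
    if "r \<in> (\<Union>c. {G (y @ [c])})" for r
  proof -
    from that obtain c where r: "r = G (y @ [c])" by blast
    then have "snd (snd r) = y @ [c]" by (simp add: G_def)
    then show ?thesis using Suc.IH[of "y @ [c]"] Suc.prems r by simp
  qed
  from exec_Seq[OF step this]
  have "exec ((Guess 1 ;; Op [0] None Right) ;; ?loop) (G y)
      (\<Union>r \<in> (\<Union>c. {G (y @ [c])}). {G (snd (snd r) @ z) | z. length z = k}) (3 + (5 * k + 1) + 1)" .
  moreover have "(\<Union>r \<in> (\<Union>c. {G (y @ [c])}). {G (snd (snd r) @ z) | z. length z = k}) =
      {G (y @ z) | z. length z = Suc k}"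
  proof -
    have "snd (snd (G x)) = x" for x by (simp add: G_def)
    moreover have "(\<exists>z. P z \<and> length z = Suc k) \<longleftrightarrow> (\<exists>c z. P (c # z) \<and> length z = k)"
      for P :: "word \<Rightarrow> bool"
      by (metis length_Suc_conv)
    ultimately show ?thesis by auto
  qed
  moreover have "\<tau> 0 0 \<in> set [1, 2]"
  proof -
    have "\<tau> 0 = tape_at (unary n) (int (length y))" by (simp add: \<tau>)
    then show ?thesis
      unfolding word_tape_nonblank using Suc.prems by (simp only: tape_at_head word_tape_nonblank) simp
  qed
  ultimately have "exec ?loop (G y) {G (y @ z) | z. length z = Suc k} (Suc (3 + (5 * k + 1) + 1))"
    unfolding G by (intro exec_While_loop) simp_all
  then show ?case by simp
qed

text \<open>The word is printed while it is guessed and the output of \<open>M\<close> is dropped,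
  so all accepting paths of \<open>M\<close> on \<open>y\<close> contribute the same output
  \<open>y\<close>.\<close>

lemma exec_guess_first:
  assumes b: "b = 1" and md: "md = Drop"
    and time: "\<And>y k c. (step M {} ^^ k) (init M [y]) c \<Longrightarrow> k \<le> poly q (length y)"
  shows "\<exists>Z. exec guess_first (input (unary n)) Z (8 * n + poly q n + 20) \<and>
    {v. \<exists>\<tau> u. (\<tau>, u, v) \<in> Z} = {y. length y = n \<and> outputs M {} [y] \<noteq> {}}"
proof -
  define \<tau> where "\<tau> y = (\<lambda>i::nat. if i = 0 then tape_at (unary n) (int (length y))
      else if i = 1 then tape_at y (int (length y)) else word_tape [])" for y
  define \<tau>' where "\<tau>' y = (\<lambda>i. if i \<in> set [1] then tape_at y (int n - int n) else \<tau> y i)" for y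
  define Z where "Z y = {place (\<tau>' y, [], y) ts w | ts w. final [y] ts w \<and> matches (\<tau>' y, [], y) w}" for y
  let ?Y = "{(\<tau> y, [] :: word, y) | y. length y = n}"
  have 1: "exec (While 0 [1, 2] (Guess 1 ;; Op [0] None Right)) (\<tau> [], [], []) ?Y (5 * n + 1)"
    using exec_guess[of "[]" n n] unfolding \<tau>_def by (simp cong: if_cong)
  have 2: "exec (rewind 1 [1] ;; Run (start M)) r (Z (snd (snd r))) (3 * n + 5 + Suc (poly q n) + 1)"
    if "r \<in> ?Y" for r
  proof -
    from that obtain y where y: "r = (\<tau> y, [], y)" "length y = n" by blast
    have "exec (rewind 1 [1]) (\<tau> y, [], y) {(\<tau>' y, [], y)} (3 * n + 5)"
      unfolding \<tau>'_def
      by (rule exec_rewind[where w = "\<lambda>_. y" and p = "\<lambda>_. int n"]) (auto simp: \<tau>_def y)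
    moreover have "exec (Run (start M)) (\<tau>' y, [], y) (Z y) (Suc (poly q n))"
      unfolding Z_def
    proof (rule exec_Run)
      show "\<tau>' y (b + i) = (if i < length [y] then word_tape ([y] ! i) else word_tape [])" for i
        by (auto simp: \<tau>'_def \<tau>_def b tape_at_0)
    qed (use time y(2) in blast)
    ultimately have "exec (rewind 1 [1] ;; Run (start M)) (\<tau> y, [], y) (Z y) (3 * n + 5 + Suc (poly q n) + 1)"
      by (rule exec_Seq_det)
    then show ?thesis unfolding y snd_conv .
  qed
  have input: "input (unary n) = (\<tau> [], [], [])"
    by (auto simp: input_def \<tau>_def tape_at_0 fun_eq_iff)
  have "exec guess_first (input (unary n)) (\<Union>r \<in> ?Y. Z (snd (snd r)))
      (5 * n + 1 + (3 * n + 5 + Suc (poly q n) + 1) + 1)"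
    unfolding guess_first_def input by (rule exec_Seq[where Z' = "\<lambda>r. Z (snd (snd r))", OF 1 2])
  then have "exec guess_first (input (unary n)) (\<Union>r \<in> ?Y. Z (snd (snd r))) (8 * n + poly q n + 20)"
    by (rule exec_mono) simp
  moreover have "{v. \<exists>\<tau> u. (\<tau>, u, v) \<in> (\<Union>r \<in> ?Y. Z (snd (snd r)))} =
      {y. length y = n \<and> outputs M {} [y] \<noteq> {}}"
  proof -
    have Y: "(\<Union>r \<in> ?Y. Z (snd (snd r))) = (\<Union>y \<in> {y. length y = n}. Z y)"
      by (simp add: setcompr_eq_image image_image)
    have Z: "(\<exists>\<tau> u. (\<tau>, u, v) \<in> Z y) \<longleftrightarrow> v = y \<and> outputs M {} [y] \<noteq> {}" for v y
      unfolding Z_def outputs_final place_def matches_def by (auto simp: md)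
    show ?thesis
    proof (intro set_eqI iffI)
      fix v assume "v \<in> {v. \<exists>\<tau> u. (\<tau>, u, v) \<in> (\<Union>r \<in> ?Y. Z (snd (snd r)))}"
      then obtain \<tau> u y where y: "length y = n" "(\<tau>, u, v) \<in> Z y"
        unfolding Y by blast
      from y(2) have "v = y \<and> outputs M {} [y] \<noteq> {}" unfolding Z[symmetric] by (intro exI)
      then show "v \<in> {y. length y = n \<and> outputs M {} [y] \<noteq> {}}" using y(1) by simp
    next
      fix v assume v: "v \<in> {y. length y = n \<and> outputs M {} [y] \<noteq> {}}"
      then have "\<exists>\<tau> u. (\<tau>, u, v) \<in> Z v" unfolding Z by simp
      with v show "v \<in> {v. \<exists>\<tau> u. (\<tau>, u, v) \<in> (\<Union>r \<in> ?Y. Z (snd (snd r)))}"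
        unfolding Y by blast
    qed
  qed
  ultimately show ?thesis by blast
qed

end

context embedding
begin

lemma fits_pairing:
  assumes "md = Query" "b = 3 + length as" "2 \<le> tapes M"
  shows "fits (b + tapes M) (parse b (b + 1) as ;; Run (start M))"
proof -
  have "fits (b + tapes M) (parse b (b + 1) as)"
    by (rule fits_parse) (use assms in auto)
  then show ?thesis unfolding fits.simps using assms(1) start_M by simp
qed

lemma fits_check_output:
  assumes "md = Compare 2" "b = 3 + length as"
  shows "fits (b + tapes M) (check_output as)"
proof -
  have "fits (b + tapes M) (parse b 2 as)"
    by (rule fits_parse) (use assms in auto)
  then show ?thesis
    unfolding check_output_def scan_def fits.simps using assms start_M by simp
qed

lemma fits_evaluate_first:
  assumes "md = Out" "b = 2 + length as"
  shows "fits (b + tapes M) (evaluate_first as)"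
proof -
  have "fits (b + tapes M) (horner b 1 as)"
    by (rule fits_horner) (use assms tapes_M in auto)
  then show ?thesis
    unfolding evaluate_first_def scan_def rewind_def fits.simps using assms start_M tapes_M by auto
qed

lemma fits_guess_first:
  assumes "md = Drop" "b = 1"
  shows "fits (b + tapes M) guess_first"
  unfolding guess_first_def rewind_def fits.simps using assms start_M tapes_M by auto

end

section \<open>Membership in the complexity classes\<close>

lemma poly_timeI:
  assumes "poly_bounded T"
    and "\<And>x k c. (step M A ^^ k) (init M [g x]) c \<Longrightarrow> k \<le> T (length (g x))"
  shows "poly_time M A (range (\<lambda>x. [g x]))"
proof -
  obtain p :: "nat poly" where p: "\<And>n. T n \<le> poly p n"
    using assms(1) unfolding poly_bounded_def by blast
  have "k \<le> poly p (length (concat [g x]))" if "(step M A ^^ k) (init M [g x]) c" for x k c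
    using le_trans[OF assms(2)[OF that] p] by simp
  then show ?thesis unfolding poly_time_def by blast
qed

lemma poly_timeE:
  assumes "poly_time M A (range (\<lambda>x. [g x]))"
  obtains q :: "nat poly" where "\<And>x k c. (step M A ^^ k) (init M [g x]) c \<Longrightarrow> k \<le> poly q (length (g x))"
proof -
  obtain q :: "nat poly" where
    "\<forall>xs \<in> range (\<lambda>x. [g x]). \<forall>k c. (step M A ^^ k) (init M xs) c \<longrightarrow> k \<le> poly q (length (concat xs))"
    using assms unfolding poly_time_def by blast
  then have "k \<le> poly q (length (g x))" if "(step M A ^^ k) (init M [g x]) c" for x k c
    using that by fastforce
  then show thesis by (rule that)
qed

text \<open>The machine for \<open>F\<close> runs unchanged in mode \<open>Query\<close>, and a
  single query then decides whether \<open>F x\<close> lies in \<open>A\<close>.\<close>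

lemma preimage_in_NP_relative:
  assumes "F \<in> class_FP"
  shows "{x. F x \<in> A} \<in> NP_relative A"
proof -
  obtain M where M: "well_formed M" "query_states M = None" "poly_time M {} (range (\<lambda>x. [x]))"
    "\<And>x. outputs M {} [x] = {F x}"
    using assms unfolding class_FP_def by blast
  interpret embedding M 0 Query
    using M by unfold_locales auto
  obtain q :: "nat poly" where
    q: "\<And>x k c. (step M {} ^^ k) (init M [x]) c \<Longrightarrow> k \<le> poly q (length x)"
    using poly_timeE[of M "{}" "\<lambda>x. x"] M(3) by blast
  let ?c = "Run (start M)" and ?K = "tapes M"
  have fits: "fits ?K ?c" using start_M by simp
  have exec: "exec ?c (input x) {place (input x) ts w | ts w. final [x] ts w \<and> matches (input x) w}
      (Suc (poly q (length x)))" for x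
    unfolding input_def by (rule exec_Run) (use q in auto)
  have "outputs (compile ?K ?c True) A [x] \<noteq> {} \<longleftrightarrow> F x \<in> A" for x
  proof -
    have "Chk 1 [] \<notin> residuals ?c" by auto
    from compile_oracle[OF fits tapes_M exec this, where A = A] show ?thesis
      unfolding input_def place_Query[OF refl] M(4) by simp
  qed
  then have "{x. F x \<in> A} = language (compile ?K ?c True) A"
    unfolding language_def by blast
  moreover have "poly_time (compile ?K ?c True) A (range (\<lambda>x. [x]))"
  proof (rule poly_timeI)
    \<comment> \<open>One step for leaving \<open>Run\<close> and one for the query.\<close>
    show "poly_bounded (\<lambda>n. poly q n + 2)" by (intro poly_bounded_intros)
    show "k \<le> poly q (length x) + 2"
      if "(step (compile ?K ?c True) A ^^ k) (init (compile ?K ?c True) [x]) y" for x k y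
      using compile_time[OF fits tapes_M exec that] by simp
  qed
  ultimately show ?thesis
    unfolding NP_relative_def using compile_well_formed[OF fits tapes_M] by blast
qed

lemma pairing_in_NP_relative:
  assumes "pairing_function pr"
  shows "{unary n @ False # u | n u. length u = poly p n \<and> pr (unary n, u) \<in> A} \<in> NP_relative A"
    (is "?L \<in> _")
proof -
  obtain M where M: "well_formed M" "2 \<le> tapes M" "query_states M = None"
    "poly_time M {} (range (\<lambda>(x, y). [x, y]))" "\<And>x y. outputs M {} [x, y] = {pr (x, y)}"
    using assms unfolding pairing_function_def by blast
  \<comment> \<open>\<open>parse\<close> compares the value with the length of \<open>u\<close> plus
    one.\<close>
  define as where "as = coeffs (p + 1)"
  have as: "horner_value as n = Suc (poly p n)" for n
    by (simp add: as_def horner_value_coeffs)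
  interpret embedding M "3 + length as" Query
    using M by unfold_locales auto
  obtain q :: "nat poly" where
    "\<forall>xs \<in> range (\<lambda>(x, y). [x, y]). \<forall>k c. (step M {} ^^ k) (init M xs) c \<longrightarrow> k \<le> poly q (length (concat xs))"
    using M(4) unfolding poly_time_def by blast
  then have q: "k \<le> poly q (length x + length y)" if "(step M {} ^^ k) (init M [x, y]) c" for x y k c
    using that by fastforce
  let ?c = "parse (3 + length as) (3 + length as + 1) as ;; Run (start M)"
    and ?K = "3 + length as + tapes M"
  have K: "1 \<le> ?K" by simp
  have fits: "fits ?K ?c" by (rule fits_pairing) (simp_all add: M(2))
  have ex: "\<exists>Z. exec ?c (input w) Z (parse_time as (length w) + Suc (poly q (length w)) + 1) \<and>
      ((\<exists>\<tau> u v. (\<tau>, u, v) \<in> Z \<and> u \<in> A) \<longleftrightarrow>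
       (\<exists>n u. w = unary n @ False # u \<and> horner_value as n = Suc (length u) \<and>
          outputs M {} [unary n, u] \<inter> A \<noteq> {}))" for w
    by (rule exec_pairing[OF refl refl M(2)]) (rule q)
  have "outputs (compile ?K ?c True) A [w] \<noteq> {} \<longleftrightarrow> w \<in> ?L" for w
  proof -
    obtain Z where
      Z: "exec ?c (input w) Z (parse_time as (length w) + Suc (poly q (length w)) + 1)" and
      iff: "(\<exists>\<tau> u v. (\<tau>, u, v) \<in> Z \<and> u \<in> A) \<longleftrightarrow>
       (\<exists>n u. w = unary n @ False # u \<and> horner_value as n = Suc (length u) \<and>
          outputs M {} [unary n, u] \<inter> A \<noteq> {})"
      using ex[of w] by (elim exE conjE) (rule that)
    have "Chk 1 [] \<notin> residuals ?c" by auto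
    from compile_oracle[OF fits K Z this, where A = A] show ?thesis
      unfolding iff by (auto simp: as M(5))
  qed
  then have "?L = language (compile ?K ?c True) A"
    unfolding language_def by blast
  moreover have "poly_time (compile ?K ?c True) A (range (\<lambda>x. [x]))"
  proof (rule poly_timeI)
    show "poly_bounded (\<lambda>n. parse_time as n + poly q n + 3)"
      by (intro poly_bounded_intros poly_bounded_parse_time)
    show "k \<le> parse_time as (length x) + poly q (length x) + 3"
      if "(step (compile ?K ?c True) A ^^ k) (init (compile ?K ?c True) [x]) y" for x k y
      using ex[of x] compile_time[OF fits K _ that] by fastforce
  qed
  ultimately show ?thesis
    unfolding NP_relative_def using compile_well_formed[OF fits K] by blast
qed

text \<open>A time bound for \<open>M\<close> on unary inputs is enough to bound all inputs of the
  new machine: whatever word it receives, it starts \<open>M\<close> on 1^n only.\<close>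

lemma padded_outputs_in_NP:
  assumes "well_formed M" "query_states M = None" "poly_time M {} (range (\<lambda>n. [unary n]))"
  shows "{unary n @ False # unary j @ False # v | n j v.
      j + length v = poly p n \<and> v \<in> outputs M {} [unary n]} \<in> class_NP" (is "?L \<in> _")
proof -
  \<comment> \<open>The word behind 1^n 0 is 1^j 0 v, whose length exceeds j plus the length of v by
    one, and \<open>parse\<close> adds one more.\<close>
  define as where "as = coeffs (p + 2)"
  have as: "horner_value as n = poly p n + 2" for n
    by (simp add: as_def horner_value_coeffs)
  interpret embedding M "3 + length as" "Compare 2"
    using assms by unfold_locales auto
  obtain q :: "nat poly" where
    q: "\<And>n k c. (step M {} ^^ k) (init M [unary n]) c \<Longrightarrow> k \<le> poly q n"
    using poly_timeE[OF assms(3)] by (metis length_unary)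
  let ?c = "check_output as" and ?K = "3 + length as + tapes M"
  have K: "1 \<le> ?K" by simp
  have fits: "fits ?K ?c" by (rule fits_check_output) simp_all
  have ex: "\<exists>Z. exec ?c (input w) Z
      (parse_time as (length w) + (5 * length w + poly q (length w) + 20) + 1) \<and>
    (Z \<noteq> {} \<longleftrightarrow> (\<exists>n j v. w = unary n @ False # unary j @ False # v \<and>
      horner_value as n = j + length v + 2 \<and> v \<in> outputs M {} [unary n]))" for w
    by (rule exec_check_output[OF refl refl]) (rule q)
  have "outputs (compile ?K ?c False) {} [w] \<noteq> {} \<longleftrightarrow> w \<in> ?L" for w
  proof -
    obtain Z where
      Z: "exec ?c (input w) Z (parse_time as (length w) + (5 * length w + poly q (length w) + 20) + 1)" and
      iff: "Z \<noteq> {} \<longleftrightarrow> (\<exists>n j v. w = unary n @ False # unary j @ False # v \<and>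
        horner_value as n = j + length v + 2 \<and> v \<in> outputs M {} [unary n])"
      using ex[of w] by (elim exE conjE) (rule that)
    have "outputs (compile ?K ?c False) {} [w] \<noteq> {} \<longleftrightarrow> Z \<noteq> {}"
      unfolding compile_outputs[OF fits K Z] by auto
    then show ?thesis unfolding iff by (auto simp: as)
  qed
  then have "?L = language (compile ?K ?c False) {}"
    unfolding language_def by blast
  moreover have "poly_time (compile ?K ?c False) {} (range (\<lambda>x. [x]))"
  proof (rule poly_timeI)
    show "poly_bounded (\<lambda>n. parse_time as n + 5 * n + poly q n + 22)"
      by (intro poly_bounded_intros poly_bounded_parse_time)
    show "k \<le> parse_time as (length x) + 5 * length x + poly q (length x) + 22"
      if "(step (compile ?K ?c False) {} ^^ k) (init (compile ?K ?c False) [x]) y" for x k y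
      using ex[of x] compile_time[OF fits K _ that] by fastforce
  qed
  ultimately show ?thesis
    unfolding class_NP_def using compile_well_formed[OF fits K] compile_simps(6)[of ?K ?c False] by auto
qed

text \<open>The program contains no \<open>Guess\<close>, so the compiled machine stays
  deterministic; the inner run takes time polynomial in a polynomial, which is again
  polynomial.\<close>

lemma FP_unary_poly:
  assumes "F \<in> class_FP"
  shows "(\<lambda>x. F (unary (poly p (length x)))) \<in> class_FP"
proof -
  obtain M where M: "well_formed M" "query_states M = None" "deterministic M"
    "poly_time M {} (range (\<lambda>x. [x]))" "\<And>x. outputs M {} [x] = {F x}"
    using assms unfolding class_FP_def by blast
  define as where "as = coeffs p"
  have as: "horner_value as n = poly p n" for n
    by (simp add: as_def horner_value_coeffs)
  interpret embedding M "2 + length as" Out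
    using M by unfold_locales auto
  obtain q :: "nat poly" where
    q: "\<And>x k c. (step M {} ^^ k) (init M [x]) c \<Longrightarrow> k \<le> poly q (length x)"
    using poly_timeE[of M "{}" "\<lambda>x. x"] M(4) by blast
  let ?c = "evaluate_first as" and ?K = "2 + length as + tapes M"
  let ?T = "\<lambda>n. 8 * n + horner_time as n + 3 * poly p n + poly q (poly p n) + 20"
  have K: "1 \<le> ?K" by simp
  have fits: "fits ?K ?c" by (rule fits_evaluate_first) simp_all
  have ex: "\<exists>Z. exec ?c (input x) Z (?T (length x)) \<and>
      {v. \<exists>\<tau> u. (\<tau>, u, v) \<in> Z} = outputs M {} [unary (poly p (length x))]" for x
    by (rule exec_evaluate_first[OF refl refl, where x = x, unfolded as]) (drule q; simp)
  have "outputs (compile ?K ?c False) {} [x] = {F (unary (poly p (length x)))}" for x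
  proof -
    obtain Z where Z: "exec ?c (input x) Z (?T (length x))" and
      out: "{v. \<exists>\<tau> u. (\<tau>, u, v) \<in> Z} = outputs M {} [unary (poly p (length x))]"
      using ex[of x] by (elim exE conjE) (rule that)
    show ?thesis unfolding compile_outputs[OF fits K Z] out M(5) ..
  qed
  moreover have "poly_time (compile ?K ?c False) {} (range (\<lambda>x. [x]))"
  proof (rule poly_timeI)
    show "poly_bounded (\<lambda>n. ?T n + 1)"
      by (intro poly_bounded_intros poly_bounded_horner_time)
    show "k \<le> ?T (length x) + 1"
      if "(step (compile ?K ?c False) {} ^^ k) (init (compile ?K ?c False) [x]) y" for x k y
      using ex[of x] compile_time[OF fits K _ that] by fastforce
  qed
  moreover have "deterministic (compile ?K ?c False)"
    by (rule compile_deterministic[OF fits _ M(3)])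
      (unfold evaluate_first_def, simp add: scan_def rewind_def guess_free_horner)
  ultimately show ?thesis
    unfolding class_FP_def using compile_well_formed[OF fits K] compile_simps(6)[of ?K ?c False] by auto
qed

text \<open>Span counts distinct outputs, so a word that \<open>M\<close> accepts along many paths
  is counted once, as in the census.\<close>

lemma census_in_spanP_1:
  assumes "L \<in> class_NP"
  shows "census L \<in> spanP_1"
proof -
  obtain M where M: "well_formed M" "query_states M = None" "poly_time M {} (range (\<lambda>x. [x]))"
    "L = language M {}"
    using assms unfolding class_NP_def by blast
  interpret embedding M 1 Drop
    using M by unfold_locales auto
  obtain q :: "nat poly" where
    q: "\<And>x k c. (step M {} ^^ k) (init M [x]) c \<Longrightarrow> k \<le> poly q (length x)"
    using poly_timeE[of M "{}" "\<lambda>x. x"] M(3) by blast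
  let ?c = guess_first and ?K = "1 + tapes M"
  have K: "1 \<le> ?K" by simp
  have fits: "fits ?K ?c" by (rule fits_guess_first) simp_all
  have ex: "\<exists>Z. exec ?c (input (unary n)) Z (8 * n + poly q n + 20) \<and>
      {v. \<exists>\<tau> u. (\<tau>, u, v) \<in> Z} = {y. length y = n \<and> outputs M {} [y] \<noteq> {}}" for n
    by (rule exec_guess_first[OF refl refl]) (rule q)
  have "census L n = card (outputs (compile ?K ?c False) {} [unary n])" for n
  proof -
    have "{x \<in> L. length x = n} = {y. length y = n \<and> outputs M {} [y] \<noteq> {}}"
      by (auto simp: M(4) language_def)
    moreover obtain Z where Z: "exec ?c (input (unary n)) Z (8 * n + poly q n + 20)" and
      out: "{v. \<exists>\<tau> u. (\<tau>, u, v) \<in> Z} = {y. length y = n \<and> outputs M {} [y] \<noteq> {}}"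
      using ex[of n] by (elim exE conjE) (rule that)
    ultimately show ?thesis unfolding compile_outputs[OF fits K Z] out census_def by simp
  qed
  moreover have "poly_time (compile ?K ?c False) {} (range (\<lambda>n. [unary n]))"
  proof (rule poly_timeI)
    show "poly_bounded (\<lambda>n. 8 * n + poly q n + 21)"
      by (intro poly_bounded_intros)
    show "k \<le> 8 * length (unary n) + poly q (length (unary n)) + 21"
      if "(step (compile ?K ?c False) {} ^^ k) (init (compile ?K ?c False) [unary n]) y" for n k y
      using ex[of n] compile_time[OF fits K _ that] by fastforce
  qed
  ultimately show ?thesis
    unfolding spanP_1_def using compile_well_formed[OF fits K] compile_simps(6)[of ?K ?c False] by auto
qed

section \<open>Census functions\<close>

text \<open>Transfers computability from a census to the function that it encodes at polynomially
  long words.\<close>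

lemma tally_FP_poly:
  assumes "g \<in> tally_FP" and "\<And>n. f n = g (poly p n)"
  shows "f \<in> tally_FP"
proof -
  obtain F where F: "F \<in> class_FP" "\<And>n. F (unary n) = binary (g n)"
    using assms(1) unfolding tally_FP_def by blast
  have "(\<lambda>x. F (unary (poly p (length x)))) \<in> class_FP"
    using F(1) by (rule FP_unary_poly)
  then show ?thesis
    unfolding tally_FP_def mem_Collect_eq
    by (rule bexI[rotated]) (simp add: F(2) assms(2))
qed

lemma NP_relative_PH:
  assumes "A \<in> class_PH" "L \<in> NP_relative A"
  shows "L \<in> class_PH"
proof -
  obtain k where "A \<in> Sigma_p k" using assms(1) unfolding class_PH_def by blast
  then have "L \<in> Sigma_p (Suc k)" using assms(2) by auto
  then show ?thesis unfolding class_PH_def by blast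
qed

text \<open>Natural coefficients make \<open>p\<close> nondecreasing, and adding the argument makes
  the sum strictly increasing; thus encoded words belonging to different \<open>n\<close> never have
  the same length.\<close>

lemma poly_plus_inject:
  fixes p :: "nat poly"
  assumes "poly p m + m = poly p n + n"
  shows "m = n"
proof (rule ccontr)
  assume "m \<noteq> n"
  then consider "m < n" | "n < m" by linarith
  then show False
    using assms poly_nat_mono[of m n p] poly_nat_mono[of n m p] by cases auto
qed

text \<open>At most one letter is printed per step; this makes the natural number
  \<open>poly p n - length v\<close>, used as padding, a true difference.\<close>

lemma output_length:
  assumes "(step M A ^^ k) (init M xs) (q, ts, u, v)"
  shows "length v \<le> k"
  using assms
proof (induction k arbitrary: q ts u v)
  case 0
  then show ?case by (simp add: init_def)
next
  case (Suc k)
  from Suc.prems obtain c where c: "(step M A ^^ k) (init M xs) c" "step M A c (q, ts, u, v)"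
    by (rule relpowp_Suc_E)
  obtain q' ts' u' v' where c': "c = (q', ts', u', v')" by (metis surj_pair)
  have "length (emit e) \<le> 1" for e by (cases e) auto
  with c(2) have "length v \<le> Suc (length v')"
    unfolding c' by (cases rule: step.cases) (auto simp: le_Suc_eq)
  also have "length v' \<le> k" using Suc.IH c(1) unfolding c' by blast
  finally show ?case by simp
qed

lemma spanP_1_tally_FP:
  assumes "\<forall>L \<in> class_NP. census L \<in> tally_FP" and "f \<in> spanP_1"
  shows "f \<in> tally_FP"
proof -
  obtain M where M: "well_formed M" "query_states M = None" "poly_time M {} (range (\<lambda>n. [unary n]))"
    "\<And>n. f n = card (outputs M {} [unary n])"
    using assms(2) unfolding spanP_1_def by blast
  obtain p :: "nat poly" where
    p: "\<And>n k c. (step M {} ^^ k) (init M [unary n]) c \<Longrightarrow> k \<le> poly p n"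
    using poly_timeE[OF M(3)] by (metis length_unary)
  have length: "length v \<le> poly p n" if "v \<in> outputs M {} [unary n]" for v n
  proof -
    obtain q ts u where "(step M {})\<^sup>*\<^sup>* (init M [unary n]) (q, ts, u, v)"
      using \<open>v \<in> outputs M {} [unary n]\<close> unfolding outputs_def by blast
    then obtain k where "(step M {} ^^ k) (init M [unary n]) (q, ts, u, v)"
      by (blast dest: rtranclp_imp_relpowp)
    then show ?thesis using output_length p by (meson le_trans)
  qed
  define L where "L = {unary n @ False # unary j @ False # v | n j v.
      j + length v = poly p n \<and> v \<in> outputs M {} [unary n]}"
  have "L \<in> class_NP" unfolding L_def by (rule padded_outputs_in_NP[OF M(1-3)])
  with assms(1) have "census L \<in> tally_FP" by blast
  \<comment> \<open>\<open>[:2, 1:]\<close> is n + 2, for 1^n and the two separating zeros.\<close>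
  moreover have "f n = census L (poly (p + [:2, 1:]) n)" for n
  proof -
    let ?e = "\<lambda>v. unary n @ False # unary (poly p n - length v) @ False # v"
    have "{x \<in> L. length x = poly (p + [:2, 1:]) n} = ?e ` outputs M {} [unary n]"
    proof (intro set_eqI iffI)
      fix x assume "x \<in> {x \<in> L. length x = poly (p + [:2, 1:]) n}"
      then obtain m j v where x: "x = unary m @ False # unary j @ False # v"
        "j + length v = poly p m" "v \<in> outputs M {} [unary m]" "length x = poly p n + n + 2"
        unfolding L_def by auto
      then have "poly p m + m = poly p n + n" by simp
      then have "m = n" by (rule poly_plus_inject)
      \<comment> \<open>The padding is forced by \<open>v\<close>, so no output is counted
        twice.\<close>
      moreover have "j = poly p m - length v" using x(2) by simp
      ultimately show "x \<in> ?e ` outputs M {} [unary n]" using x(1,3) by blast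
    next
      fix x assume "x \<in> ?e ` outputs M {} [unary n]"
      then obtain v where v: "v \<in> outputs M {} [unary n]" "x = ?e v" by blast
      have "x \<in> L" unfolding L_def using v length[OF v(1)] by fastforce
      moreover have "length x = poly (p + [:2, 1:]) n" using v(2) length[OF v(1)] by simp
      ultimately show "x \<in> {x \<in> L. length x = poly (p + [:2, 1:]) n}" by blast
    qed
    moreover have "inj_on ?e (outputs M {} [unary n])"
      by (rule inj_onI) simp
    ultimately show ?thesis
      unfolding census_def M(4) by (simp only: card_image)
  qed
  ultimately show ?thesis by (rule tally_FP_poly)
qed

lemma sharp_1_tally_FP:
  assumes "\<forall>L \<in> class_PH. census L \<in> tally_FP" and "pairing_function pr" and "f \<in> sharp_1 pr class_PH"
  shows "f \<in> tally_FP"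
proof -
  obtain A and p :: "nat poly" where A: "A \<in> class_PH"
    "\<And>n. f n = card {y. length y = poly p n \<and> pr (unary n, y) \<in> A}"
    using assms(3) unfolding sharp_1_def by blast
  define L where "L = {unary n @ False # u | n u. length u = poly p n \<and> pr (unary n, u) \<in> A}"
  have "L \<in> class_PH"
    unfolding L_def using A(1) pairing_in_NP_relative[OF assms(2)] by (rule NP_relative_PH)
  with assms(1) have "census L \<in> tally_FP" by blast
  \<comment> \<open>\<open>[:1, 1:]\<close> is n + 1, for 1^n and the single separating
    zero.\<close>
  moreover have "f n = census L (poly (p + [:1, 1:]) n)" for n
  proof -
    let ?e = "\<lambda>u. unary n @ False # u"
    have "{x \<in> L. length x = poly (p + [:1, 1:]) n} =
        ?e ` {y. length y = poly p n \<and> pr (unary n, y) \<in> A}"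
    proof (intro set_eqI iffI)
      fix x assume "x \<in> {x \<in> L. length x = poly (p + [:1, 1:]) n}"
      then obtain m u where x: "x = unary m @ False # u"
        "length u = poly p m" "pr (unary m, u) \<in> A" "length x = poly p n + n + 1"
        unfolding L_def by auto
      then have "poly p m + m = poly p n + n" by simp
      then have "m = n" by (rule poly_plus_inject)
      then show "x \<in> ?e ` {y. length y = poly p n \<and> pr (unary n, y) \<in> A}" using x by blast
    next
      fix x assume "x \<in> ?e ` {y. length y = poly p n \<and> pr (unary n, y) \<in> A}"
      then show "x \<in> {x \<in> L. length x = poly (p + [:1, 1:]) n}"
        unfolding L_def by auto
    qed
    moreover have "inj_on ?e {y. length y = poly p n \<and> pr (unary n, y) \<in> A}"
      by (rule inj_onI) simp
    ultimately show ?thesis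
      unfolding census_def A(2) by (simp only: card_image)
  qed
  ultimately show ?thesis by (rule tally_FP_poly)
qed

text \<open>The set \<open>?A\<close> looks only at the second component of a pair; with the
  identity \<open>[:0, 1:]\<close> as length polynomial, the counted words are those of length
  \<open>n\<close> in \<open>L\<close>.\<close>

lemma census_in_sharp_1:
  assumes "pairing_function pr" and "L \<in> class_PH"
  shows "census L \<in> sharp_1 pr class_PH"
proof -
  have pr: "bij pr" "snd \<circ> inv pr \<in> class_FP"
    using assms(1) unfolding pairing_function_def by blast+
  let ?A = "{x. (snd \<circ> inv pr) x \<in> L}"
  have A: "?A \<in> class_PH"
    using assms(2) preimage_in_NP_relative[OF pr(2)] by (rule NP_relative_PH)
  have "inv pr (pr z) = z" for z
    using pr(1) by (simp add: bij_is_inj)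
  then have "census L n = card {y. length y = poly [:0, 1:] n \<and> pr (unary n, y) \<in> ?A}" for n
    unfolding census_def by (auto intro!: arg_cong[where f = card])
  then show ?thesis
    unfolding sharp_1_def using A by blast
qed

theorem theorem3p5:
  shows "((\<forall>L \<in> class_NP. census L \<in> tally_FP) \<longleftrightarrow> spanP_1 \<subseteq> tally_FP) \<and>
    (\<forall>pr. pairing_function pr \<longrightarrow>
       ((\<forall>L \<in> class_PH. census L \<in> tally_FP) \<longleftrightarrow> sharp_1 pr class_PH \<subseteq> tally_FP))"
  using spanP_1_tally_FP census_in_spanP_1 sharp_1_tally_FP census_in_sharp_1 by blast

end
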